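(* It is undecidable whether a given LocalMax GNN with semilinear combination functions is key-invariant.
   Context: Fix a finite set $\Pi=\{p_1,\dots,p_n\}$ of propositions. A graph is $G=(V,E,\mathrm{lab})$ with $V$ finite, $E\subseteq V\times V$ irreflexive and symmetric, $\mathrm{lab}:V\to\{0,1\}^n$; a pointed graph $G^u$ has distinguished node $u$. A keyed extension adds an injective $\mathrm{key}:V\to\mathbb{R}$. A GNN is a sequence of layers $(\mathrm{agg}_i,\mathrm{com}_i)_{i=1}^\ell$, $\mathrm{com}_i:\mathbb{R}^{2D_i}\to\mathbb{R}^{D_{i+1}}$, $D_1=n+1$, $D_{\ell+1}=1$; on a keyed graph the initial embedding is $\mathrm{lab}(v)\oplus(\mathrm{key}(v))$, each layer computes $\mathrm{emb}'(u)=\mathrm{com}_i(\mathrm{emb}(u),\mathrm{agg}_i(\{\!\{\mathrm{emb}(v)\mid(u,v)\in E\}\!\}))$, output is the final value at the distinguished node. LocalMax: each $\mathrm{agg}_i$ is coordinate-wise maximum (empty max $=0$). The GNN accepts a keyed pointed graph iff output $>0$; it is key-invariant if for every pointed graph either all its keyed extensions are accepted or all are rejected. Semilinear combination functions are those whose coordinates are definable by first-order formulas without parameters over $(\mathbb{R},+,<,0,1)$; equivalently compositions of affine functions with rational coefficients and $\mathrm{ifPos}(x,y,z)=y$ if $x>0$, $z$ otherwise. A GNN is given as input via such finite descriptions of its combination functions. *)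

theory Defs
  imports Complex_Main "HOL-Library.Multiset" "HOL-Library.Nat_Bijection"
begin

section \<open>Decidability: partial recursive functions\<close>

datatype recf =
    Zero
  | Succ
  | Proj nat
  | Comp recf "recf list"
  | PrimRec recf recf
  | Mu recf

inductive computes :: "recf \<Rightarrow> nat list \<Rightarrow> nat \<Rightarrow> bool" where
  zero: "computes Zero xs 0"
| succ: "computes Succ [x] (Suc x)"
| proj: "i < length xs \<Longrightarrow> computes (Proj i) xs (xs ! i)"
| comp: "list_all2 (\<lambda>g y. computes g xs y) gs ys \<Longrightarrow> computes f ys z \<Longrightarrow> computes (Comp f gs) xs z"
| prim_0: "computes f xs y \<Longrightarrow> computes (PrimRec f g) (0 # xs) y"
| prim_Suc: "computes (PrimRec f g) (m # xs) r \<Longrightarrow> computes g (m # r # xs) y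
    \<Longrightarrow> computes (PrimRec f g) (Suc m # xs) y"
| mu: "computes f (m # xs) 0 \<Longrightarrow> (\<forall>k<m. \<exists>y. computes f (k # xs) (Suc y)) \<Longrightarrow> computes (Mu f) xs m"

lemma computes_deterministic:
  "computes f xs y \<Longrightarrow> computes f xs z \<Longrightarrow> y = z"
proof (induction arbitrary: z rule: computes.induct)
  case (comp xs gs ys f w)
  from comp.prems obtain ys' where ys': "list_all2 (\<lambda>g y. computes g xs y) gs ys'"
    and f: "computes f ys' z"
    by (cases rule: computes.cases) auto
  have "ys = ys'"
    using comp.IH(1) ys' by (auto simp: list_all2_conv_all_nth list_eq_iff_nth_eq)
  then show ?case using comp.IH(2) f by blast
next
  case (prim_0 f xs y g)
  from prim_0.prems show ?case
    by (cases rule: computes.cases) (auto intro: prim_0.IH)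
next
  case (prim_Suc f g m xs r y)
  from prim_Suc.prems obtain r' where "computes (PrimRec f g) (m # xs) r'"
    and "computes g (m # r' # xs) z"
    by (cases rule: computes.cases) auto
  then show ?case using prim_Suc.IH by blast
next
  case (mu f m xs)
  from mu.prems have z: "computes f (z # xs) 0" "\<forall>k<z. \<exists>y. computes f (k # xs) (Suc y)"
    by (cases rule: computes.cases; auto)+
  have "\<not> z < m" using mu.IH z(1) by blast
  moreover have "\<not> m < z" using mu.IH(1) z(2) by blast
  ultimately show ?case by simp
qed (auto elim: computes.cases)

text \<open>The instances of the decision problem are the elements of \<open>I\<close>, presented through the
  coding \<open>enc\<close>; nothing is required of the decision procedure on numbers coding no instance.\<close>

definition decidable_on :: "('a \<Rightarrow> nat) \<Rightarrow> 'a set \<Rightarrow> ('a \<Rightarrow> bool) \<Rightarrow> bool" where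
  "decidable_on enc I P \<longleftrightarrow> (\<exists>f. \<forall>x\<in>I. computes f [enc x] (if P x then 1 else 0))"


section \<open>Graphs\<close>

record 'v graph =
  verts :: "'v set"
  edges :: "('v \<times> 'v) set"
  lab :: "'v \<Rightarrow> bool list"

definition is_graph :: "nat \<Rightarrow> 'v graph \<Rightarrow> bool" where
  "is_graph n G \<longleftrightarrow> finite (verts G) \<and> edges G \<subseteq> verts G \<times> verts G \<and>
     irrefl (edges G) \<and> sym (edges G) \<and> (\<forall>v\<in>verts G. length (lab G v) = n)"

definition is_keying :: "'v graph \<Rightarrow> ('v \<Rightarrow> real) \<Rightarrow> bool" where
  "is_keying G key \<longleftrightarrow> inj_on key (verts G)"


section \<open>Graph neural networks\<close>

type_synonym vec = "real list"

text \<open>The combination function of a layer with input dimension \<open>D\<close> is applied to the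
  concatenation of two vectors of length \<open>D\<close>.\<close>

type_synonym layer = "(vec multiset \<Rightarrow> vec) \<times> (vec \<Rightarrow> vec)"
type_synonym gnn = "layer list"

fun is_gnn :: "nat \<Rightarrow> gnn \<Rightarrow> bool" where
  "is_gnn D [] \<longleftrightarrow> D = 1"
| "is_gnn D ((agg, com) # N) \<longleftrightarrow>
     (\<forall>M. (\<forall>x\<in>#M. length x = D) \<longrightarrow> length (agg M) = D) \<and>
     (\<exists>D'. (\<forall>x. length x = 2 * D \<longrightarrow> length (com x) = D') \<and> is_gnn D' N)"

fun run :: "'v graph \<Rightarrow> gnn \<Rightarrow> ('v \<Rightarrow> vec) \<Rightarrow> 'v \<Rightarrow> vec" where
  "run G [] emb = emb"
| "run G ((agg, com) # N) emb =
     run G N (\<lambda>u. com (emb u @ agg {# emb v. v \<in># mset_set {v. (u, v) \<in> edges G} #}))"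

definition init_emb :: "'v graph \<Rightarrow> ('v \<Rightarrow> real) \<Rightarrow> 'v \<Rightarrow> vec" where
  "init_emb G key v = map of_bool (lab G v) @ [key v]"

definition accepts :: "gnn \<Rightarrow> 'v graph \<Rightarrow> ('v \<Rightarrow> real) \<Rightarrow> 'v \<Rightarrow> bool" where
  "accepts N G key u \<longleftrightarrow> run G N (init_emb G key) u ! 0 > 0"

text \<open>Every finite graph is isomorphic to one whose nodes are natural numbers.\<close>

definition key_invariant :: "nat \<Rightarrow> gnn \<Rightarrow> bool" where
  "key_invariant n N \<longleftrightarrow> (\<forall>(G :: nat graph) u. is_graph n G \<and> u \<in> verts G \<longrightarrow>
     (\<forall>key. is_keying G key \<longrightarrow> accepts N G key u) \<or>
     (\<forall>key. is_keying G key \<longrightarrow> \<not> accepts N G key u))"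

definition max_agg :: "nat \<Rightarrow> vec multiset \<Rightarrow> vec" where
  "max_agg D M = map (\<lambda>j. if M = {#} then 0 else Max ((\<lambda>x. x ! j) ` set_mset M)) [0..<D]"


section \<open>Finite descriptions of LocalMax GNNs\<close>

text \<open>A layer is described by the list of descriptions of the coordinates of its combination
  function. The parameter \<open>ok m d\<close> says that \<open>d\<close> describes a function from
  \<open>m\<close>-dimensional vectors to reals, and \<open>sem d\<close> is that function.\<close>

fun wf_descr :: "(nat \<Rightarrow> 'd \<Rightarrow> bool) \<Rightarrow> nat \<Rightarrow> 'd list list \<Rightarrow> bool" where
  "wf_descr ok D [] \<longleftrightarrow> D = 1"
| "wf_descr ok D (ds # ls) \<longleftrightarrow> (\<forall>d\<in>set ds. ok (2 * D) d) \<and> wf_descr ok (length ds) ls"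

fun localmax_gnn :: "('d \<Rightarrow> vec \<Rightarrow> real) \<Rightarrow> nat \<Rightarrow> 'd list list \<Rightarrow> gnn" where
  "localmax_gnn sem D [] = []"
| "localmax_gnn sem D (ds # ls) =
     (max_agg D, \<lambda>x. map (\<lambda>d. sem d x) ds) # localmax_gnn sem (length ds) ls"

definition enc_descr :: "('d \<Rightarrow> nat) \<Rightarrow> 'd list list \<Rightarrow> nat" where
  "enc_descr enc ls = list_encode (map (\<lambda>ds. list_encode (map enc ds)) ls)"

lemma is_gnn_localmax_gnn: "wf_descr ok D ls \<Longrightarrow> is_gnn D (localmax_gnn sem D ls)"
  by (induction ls arbitrary: D) (auto simp: max_agg_def)

lemma inj_enc_descr: "inj enc \<Longrightarrow> inj (enc_descr enc)"
proof (rule injI)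
  fix ls ls' assume "inj enc" and eq: "enc_descr enc ls = enc_descr enc ls'"
  then have "inj (\<lambda>ds. list_encode (map enc ds))"
    by (auto intro!: injI simp: inj_map_eq_map list_encode_eq)
  then show "ls = ls'"
    using eq by (simp add: enc_descr_def inj_map_eq_map list_encode_eq)
qed


subsection \<open>First-order formulas over the ordered additive group of the reals with 0 and 1\<close>

datatype fo_term = TVar nat | TZero | TOne | TPlus fo_term fo_term

datatype fo_form =
    FEq fo_term fo_term
  | FLess fo_term fo_term
  | FNot fo_form
  | FAnd fo_form fo_form
  | FEx nat fo_form

fun tm_val :: "(nat \<Rightarrow> real) \<Rightarrow> fo_term \<Rightarrow> real" where
  "tm_val e (TVar i) = e i"
| "tm_val e TZero = 0"
| "tm_val e TOne = 1"
| "tm_val e (TPlus s t) = tm_val e s + tm_val e t"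

fun sat :: "(nat \<Rightarrow> real) \<Rightarrow> fo_form \<Rightarrow> bool" where
  "sat e (FEq s t) \<longleftrightarrow> tm_val e s = tm_val e t"
| "sat e (FLess s t) \<longleftrightarrow> tm_val e s < tm_val e t"
| "sat e (FNot \<phi>) \<longleftrightarrow> \<not> sat e \<phi>"
| "sat e (FAnd \<phi> \<psi>) \<longleftrightarrow> sat e \<phi> \<and> sat e \<psi>"
| "sat e (FEx i \<phi>) \<longleftrightarrow> (\<exists>r. sat (e(i := r)) \<phi>)"

fun tm_vars :: "fo_term \<Rightarrow> nat set" where
  "tm_vars (TVar i) = {i}"
| "tm_vars TZero = {}"
| "tm_vars TOne = {}"
| "tm_vars (TPlus s t) = tm_vars s \<union> tm_vars t"

fun free_vars :: "fo_form \<Rightarrow> nat set" where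
  "free_vars (FEq s t) = tm_vars s \<union> tm_vars t"
| "free_vars (FLess s t) = tm_vars s \<union> tm_vars t"
| "free_vars (FNot \<phi>) = free_vars \<phi>"
| "free_vars (FAnd \<phi> \<psi>) = free_vars \<phi> \<union> free_vars \<psi>"
| "free_vars (FEx i \<phi>) = free_vars \<phi> - {i}"

text \<open>The graph of the function is defined with the arguments in the variables
  \<open>0, \<dots>, m - 1\<close> and the value in the variable \<open>m\<close>.\<close>

definition fo_ok :: "nat \<Rightarrow> fo_form \<Rightarrow> bool" where
  "fo_ok m \<phi> \<longleftrightarrow> free_vars \<phi> \<subseteq> {..m} \<and>
     (\<forall>x. length x = m \<longrightarrow> (\<exists>!y. sat ((!) (x @ [y])) \<phi>))"

definition fo_fun :: "fo_form \<Rightarrow> vec \<Rightarrow> real" where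
  "fo_fun \<phi> x = (THE y. sat ((!) (x @ [y])) \<phi>)"

fun enc_term :: "fo_term \<Rightarrow> nat" where
  "enc_term (TVar i) = prod_encode (0, i)"
| "enc_term TZero = prod_encode (1, 0)"
| "enc_term TOne = prod_encode (2, 0)"
| "enc_term (TPlus s t) = prod_encode (3, prod_encode (enc_term s, enc_term t))"

fun enc_form :: "fo_form \<Rightarrow> nat" where
  "enc_form (FEq s t) = prod_encode (0, prod_encode (enc_term s, enc_term t))"
| "enc_form (FLess s t) = prod_encode (1, prod_encode (enc_term s, enc_term t))"
| "enc_form (FNot \<phi>) = prod_encode (2, enc_form \<phi>)"
| "enc_form (FAnd \<phi> \<psi>) = prod_encode (3, prod_encode (enc_form \<phi>, enc_form \<psi>))"
| "enc_form (FEx i \<phi>) = prod_encode (4, prod_encode (i, enc_form \<phi>))"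

lemma inj_enc_term: "inj enc_term"
proof (rule injI)
  show "enc_term s = enc_term t \<Longrightarrow> s = t" for s t
    by (induction s arbitrary: t; case_tac t) (auto simp: prod_encode_eq)
qed

lemma inj_enc_form: "inj enc_form"
proof (rule injI)
  show "enc_form \<phi> = enc_form \<psi> \<Longrightarrow> \<phi> = \<psi>" for \<phi> \<psi>
    by (induction \<phi> arbitrary: \<psi>; case_tac \<psi>)
      (auto simp: prod_encode_eq inj_eq[OF inj_enc_term])
qed


subsection \<open>Compositions of rational affine functions and ifPos\<close>

text \<open>Affine functions with rational coefficients are built from rational constants, addition
  and multiplication by rationals.\<close>

datatype sexp =
    SVar nat
  | SConst rat
  | SAdd sexp sexp
  | SScale rat sexp
  | SIfPos sexp sexp sexp

fun sexp_fun :: "sexp \<Rightarrow> vec \<Rightarrow> real" where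
  "sexp_fun (SVar i) x = x ! i"
| "sexp_fun (SConst q) x = of_rat q"
| "sexp_fun (SAdd s t) x = sexp_fun s x + sexp_fun t x"
| "sexp_fun (SScale q s) x = of_rat q * sexp_fun s x"
| "sexp_fun (SIfPos s t u) x = (if sexp_fun s x > 0 then sexp_fun t x else sexp_fun u x)"

fun sexp_vars :: "sexp \<Rightarrow> nat set" where
  "sexp_vars (SVar i) = {i}"
| "sexp_vars (SConst q) = {}"
| "sexp_vars (SAdd s t) = sexp_vars s \<union> sexp_vars t"
| "sexp_vars (SScale q s) = sexp_vars s"
| "sexp_vars (SIfPos s t u) = sexp_vars s \<union> sexp_vars t \<union> sexp_vars u"

definition sexp_ok :: "nat \<Rightarrow> sexp \<Rightarrow> bool" where
  "sexp_ok m s \<longleftrightarrow> sexp_vars s \<subseteq> {..<m}"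

definition enc_rat :: "rat \<Rightarrow> nat" where
  "enc_rat q = prod_encode (int_encode (fst (quotient_of q)), int_encode (snd (quotient_of q)))"

fun enc_sexp :: "sexp \<Rightarrow> nat" where
  "enc_sexp (SVar i) = prod_encode (0, i)"
| "enc_sexp (SConst q) = prod_encode (1, enc_rat q)"
| "enc_sexp (SAdd s t) = prod_encode (2, prod_encode (enc_sexp s, enc_sexp t))"
| "enc_sexp (SScale q s) = prod_encode (3, prod_encode (enc_rat q, enc_sexp s))"
| "enc_sexp (SIfPos s t u) =
     prod_encode (4, prod_encode (enc_sexp s, prod_encode (enc_sexp t, enc_sexp u)))"

lemma inj_enc_rat: "inj enc_rat"
  by (intro injI) (simp add: enc_rat_def prod_encode_eq int_encode_eq prod_eq_iff
      flip: quotient_of_inject_eq)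

lemma inj_enc_sexp: "inj enc_sexp"
proof (rule injI)
  show "enc_sexp s = enc_sexp t \<Longrightarrow> s = t" for s t
    by (induction s arbitrary: t; case_tac t)
      (auto simp: prod_encode_eq inj_eq[OF inj_enc_rat])
qed

end

theory Submission
  imports Defs
begin

text \<open>A derivation from Horn clauses can be stored in a keyed graph and checked locally: the type of
  a node is the integer part of its key, a hub has the key \<open>\<epsilon>\<close>, a register of value \<open>a\<close> has the
  fractional part \<open>(a + 1) \<epsilon>\<close>, and a clause instance is a node adjacent to the hub, to one register
  for each of its variables, and to its premises, whose keys have smaller fractional parts. As keys
  are distinct, maximum aggregation can test that a node has a unique neighbor of a given type and
  read off its key, and a semilinear function can compare the arguments of atoms, which only use
  zero and successor. The derivations of \<open>computes g [x] (Suc y)\<close> are of this kind, so some graph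
  has an accepted keying iff \<open>g\<close> has a positive value at \<open>x\<close>; negating all keys then yields a
  rejected keying. The input \<open>x\<close> enters the network only through a first layer computing \<open>x\<close> times
  the key. Given a decision procedure, let \<open>g\<close> apply it to the network whose remaining layers have
  code \<open>x\<close> and whose first layer carries the input \<open>x\<close>; choosing for \<open>x\<close> the code of the remaining
  layers of the network for \<open>g\<close> itself gives a contradiction.\<close>

section \<open>Closure properties of recursive functions\<close>

text \<open>Totality and a fixed arity are enough: only the map from an input to the code of a
  network has to be shown recursive. Lists of any other length are left unconstrained.\<close>

definition rec_fun :: "nat \<Rightarrow> (nat list \<Rightarrow> nat) \<Rightarrow> bool" where
  "rec_fun k h \<longleftrightarrow> (\<exists>r. \<forall>xs. length xs = k \<longrightarrow> computes r xs (h xs))"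

lemma rec_fun_proj: "i < k \<Longrightarrow> rec_fun k (\<lambda>xs. xs ! i)"
  unfolding rec_fun_def by (intro exI[of _ "Proj i"]) (auto intro: computes.proj)

lemma rec_fun_Suc:
  assumes "rec_fun k h" shows "rec_fun k (\<lambda>xs. Suc (h xs))"
proof -
  obtain r where "\<And>xs. length xs = k \<Longrightarrow> computes r xs (h xs)"
    using assms unfolding rec_fun_def by blast
  then show ?thesis unfolding rec_fun_def
    by (intro exI[of _ "Comp Succ [r]"] allI impI computes.comp[where ys = "[h _]"])
      (auto intro: computes.succ)
qed

lemma rec_fun_const: "rec_fun k (\<lambda>xs. c)"
proof (induction c)
  case 0
  show ?case unfolding rec_fun_def by (blast intro: computes.zero)
qed (rule rec_fun_Suc)

lemma rec_fun_comp2: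
  assumes "rec_fun 2 F" "rec_fun k g" "rec_fun k h"
  shows "rec_fun k (\<lambda>xs. F [g xs, h xs])"
proof -
  obtain r s t where "\<And>xs. length xs = 2 \<Longrightarrow> computes r xs (F xs)"
    "\<And>xs. length xs = k \<Longrightarrow> computes s xs (g xs)" "\<And>xs. length xs = k \<Longrightarrow> computes t xs (h xs)"
    using assms unfolding rec_fun_def by blast
  then show ?thesis unfolding rec_fun_def
    by (intro exI[of _ "Comp r [s, t]"] allI impI computes.comp[where ys = "[g _, h _]"]) auto
qed

lemma rec_fun_comp1:
  assumes "rec_fun 1 F" "rec_fun k g"
  shows "rec_fun k (\<lambda>xs. F [g xs])"
proof -
  obtain r s where "\<And>xs. length xs = 1 \<Longrightarrow> computes r xs (F xs)"
    "\<And>xs. length xs = k \<Longrightarrow> computes s xs (g xs)"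
    using assms unfolding rec_fun_def by blast
  then show ?thesis unfolding rec_fun_def
    by (intro exI[of _ "Comp r [s]"] allI impI computes.comp[where ys = "[g _]"]) auto
qed

lemma rec_fun_prim_rec:
  assumes "rec_fun k f" "rec_fun (Suc (Suc k)) g"
  shows "rec_fun (Suc k) (\<lambda>xs. rec_nat (f (tl xs)) (\<lambda>m r. g (m # r # tl xs)) (hd xs))"
proof -
  obtain r s where r: "\<And>xs. length xs = k \<Longrightarrow> computes r xs (f xs)"
    and s: "\<And>xs. length xs = Suc (Suc k) \<Longrightarrow> computes s xs (g xs)"
    using assms unfolding rec_fun_def by blast
  have "computes (PrimRec r s) (m # xs) (rec_nat (f xs) (\<lambda>m r. g (m # r # xs)) m)"
    if "length xs = k" for m xs
    by (induction m) (use that in \<open>auto intro!: computes.prim_0 computes.prim_Suc r s\<close>)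
  then show ?thesis unfolding rec_fun_def
    by (intro exI[of _ "PrimRec r s"]) (auto simp: length_Suc_conv)
qed

lemma rec_fun_cong:
  "rec_fun k g \<Longrightarrow> (\<And>xs. length xs = k \<Longrightarrow> g xs = h xs) \<Longrightarrow> rec_fun k h"
  unfolding rec_fun_def by metis

lemma rec_fun_add:
  assumes "rec_fun k g" "rec_fun k h"
  shows "rec_fun k (\<lambda>xs. g xs + h xs)"
proof -
  have "rec_fun 2 (\<lambda>xs. xs ! 0 + xs ! 1)"
  proof (rule rec_fun_cong)
    show "rec_fun 2 (\<lambda>xs. rec_nat ((\<lambda>xs. xs ! 0) (tl xs))
        (\<lambda>m r. (\<lambda>xs. Suc (xs ! 1)) (m # r # tl xs)) (hd xs))"
      unfolding numeral_2_eq_2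
      by (intro rec_fun_prim_rec rec_fun_Suc rec_fun_proj) auto
    fix xs :: "nat list" assume "length xs = 2"
    then obtain x y where xs: "xs = [x, y]" by (auto simp: numeral_2_eq_2 length_Suc_conv)
    have "rec_nat y (\<lambda>m. Suc) x = x + y" by (induction x) auto
    then show "rec_nat ((\<lambda>xs. xs ! 0) (tl xs)) (\<lambda>m r. (\<lambda>xs. Suc (xs ! 1)) (m # r # tl xs)) (hd xs)
      = xs ! 0 + xs ! 1" by (simp add: xs)
  qed
  from rec_fun_comp2[OF this assms] show ?thesis by simp
qed

text \<open>Cantor pairing is \<open>triangle (m + n) + m\<close>, and \<open>triangle\<close> is a
  primitive recursion. Codes of formulas and of lists are built from pairings and successors, so
  they are computable from the codes of their parts.\<close>

lemma rec_fun_prod_encode: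
  assumes "rec_fun k g" "rec_fun k h"
  shows "rec_fun k (\<lambda>xs. prod_encode (g xs, h xs))"
proof -
  have "rec_fun 1 (\<lambda>xs. triangle (xs ! 0))"
  proof (rule rec_fun_cong)
    show "rec_fun 1 (\<lambda>xs. rec_nat ((\<lambda>xs. 0) (tl xs))
        (\<lambda>m r. (\<lambda>xs. xs ! 1 + Suc (xs ! 0)) (m # r # tl xs)) (hd xs))"
      unfolding One_nat_def
      by (intro rec_fun_prim_rec rec_fun_add rec_fun_Suc rec_fun_proj rec_fun_const) auto
    fix xs :: "nat list" assume "length xs = 1"
    then obtain x where xs: "xs = [x]" by (auto simp: length_Suc_conv)
    have "rec_nat 0 (\<lambda>m r. r + Suc m) x = triangle x" by (induction x) auto
    then show "rec_nat ((\<lambda>xs. 0) (tl xs)) (\<lambda>m r. (\<lambda>xs. xs ! 1 + Suc (xs ! 0)) (m # r # tl xs)) (hd xs)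
      = triangle (xs ! 0)" by (simp add: xs)
  qed
  from rec_fun_comp1[OF this rec_fun_add[OF assms]]
  show ?thesis unfolding prod_encode_def by (simp add: rec_fun_add assms)
qed

section \<open>Semilinear functions\<close>

text \<open>A subclass with integer coefficients suffices for the checker, and both description
  languages can imitate its closure operations. Coordinates are names of an arbitrary type
  \<open>'c\<close>, and \<open>V\<close> bounds the names that a function may read.\<close>

inductive_set semilinear :: "'c set \<Rightarrow> (('c \<Rightarrow> real) \<Rightarrow> real) set" for V where
  semilinear_var: "c \<in> V \<Longrightarrow> (\<lambda>e. e c) \<in> semilinear V"
| semilinear_zero: "(\<lambda>e. 0) \<in> semilinear V"
| semilinear_one: "(\<lambda>e. 1) \<in> semilinear V"
| semilinear_add: "F \<in> semilinear V \<Longrightarrow> G \<in> semilinear V \<Longrightarrow> (\<lambda>e. F e + G e) \<in> semilinear V"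
| semilinear_minus: "F \<in> semilinear V \<Longrightarrow> (\<lambda>e. - F e) \<in> semilinear V"
| semilinear_ifPos: "F \<in> semilinear V \<Longrightarrow> G \<in> semilinear V \<Longrightarrow> H \<in> semilinear V \<Longrightarrow>
    (\<lambda>e. if 0 < F e then G e else H e) \<in> semilinear V"

lemma semilinear_depends: "F \<in> semilinear V \<Longrightarrow> (\<And>c. c \<in> V \<Longrightarrow> e c = e' c) \<Longrightarrow> F e = F e'"
  by (induction rule: semilinear.induct) auto

lemma semilinear_rename:
  "F \<in> semilinear V \<Longrightarrow> \<rho> ` V \<subseteq> W \<Longrightarrow> (\<lambda>e. F (\<lambda>c. e (\<rho> c))) \<in> semilinear W"
  by (induction rule: semilinear.induct) (auto intro: semilinear.intros)

lemma semilinear_mono: "F \<in> semilinear V \<Longrightarrow> V \<subseteq> W \<Longrightarrow> F \<in> semilinear W"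
  using semilinear_rename[of F V "\<lambda>c. c" W] by simp

text \<open>A function is built from finitely many variables. This turns a layer over an infinite
  type of names into one of finite dimension.\<close>

lemma semilinear_finite_support:
  "F \<in> semilinear V \<Longrightarrow> \<exists>W. finite W \<and> W \<subseteq> V \<and> F \<in> semilinear W"
proof (induction rule: semilinear.induct)
  case (semilinear_var c)
  then show ?case by (intro exI[of _ "{c}"]) (auto intro: semilinear.intros)
next
  case (semilinear_add F G)
  then obtain W1 W2 where "finite W1" "W1 \<subseteq> V" "F \<in> semilinear W1"
    "finite W2" "W2 \<subseteq> V" "G \<in> semilinear W2" by blast
  then show ?case
    by (intro exI[of _ "W1 \<union> W2"]) (auto intro!: semilinear.semilinear_add intro: semilinear_mono)
next
  case (semilinear_ifPos F G H)
  then obtain W1 W2 W3 where "finite W1" "W1 \<subseteq> V" "F \<in> semilinear W1"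
    "finite W2" "W2 \<subseteq> V" "G \<in> semilinear W2" "finite W3" "W3 \<subseteq> V" "H \<in> semilinear W3" by blast
  then show ?case
    by (intro exI[of _ "W1 \<union> W2 \<union> W3"])
      (auto intro!: semilinear.semilinear_ifPos intro: semilinear_mono)
qed (auto intro: semilinear.intros)

lemma semilinear_of_nat: "(\<lambda>e. of_nat k) \<in> semilinear V"
proof (induction k)
  case (Suc k)
  show ?case using semilinear_add[OF semilinear_one Suc.IH] by simp
qed (simp add: semilinear_zero)

lemma semilinear_numeral: "(\<lambda>e. numeral k) \<in> semilinear V"
  using semilinear_of_nat[of "numeral k"] by simp

lemma semilinear_diff:
  assumes "F \<in> semilinear V" "G \<in> semilinear V" shows "(\<lambda>e. F e - G e) \<in> semilinear V"
  using semilinear_add[OF assms(1) semilinear_minus[OF assms(2)]] by simp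

section \<open>Predicates with a semilinear indicator function\<close>

definition semilinear_pred :: "'c set \<Rightarrow> (('c \<Rightarrow> real) \<Rightarrow> bool) \<Rightarrow> bool" where
  "semilinear_pred V P \<longleftrightarrow> (\<lambda>e. of_bool (P e)) \<in> semilinear V"

lemma semilinear_if:
  assumes "semilinear_pred V P" "F \<in> semilinear V" "G \<in> semilinear V"
  shows "(\<lambda>e. if P e then F e else G e) \<in> semilinear V"
  using semilinear_ifPos[OF assms(1)[unfolded semilinear_pred_def] assms(2,3)] by simp

lemma semilinear_pred_const: "semilinear_pred V (\<lambda>e. b)"
  unfolding semilinear_pred_def by (cases b) (simp_all add: semilinear_zero semilinear_one)

lemma semilinear_pred_less:
  assumes "F \<in> semilinear V" "G \<in> semilinear V"
  shows "semilinear_pred V (\<lambda>e. F e < G e)"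
  using semilinear_ifPos[OF semilinear_diff[OF assms(2,1)] semilinear_one semilinear_zero]
  unfolding semilinear_pred_def of_bool_def by simp

lemma semilinear_pred_not:
  assumes "semilinear_pred V P" shows "semilinear_pred V (\<lambda>e. \<not> P e)"
proof -
  have "(\<lambda>e. of_bool (\<not> P e)) = (\<lambda>e. if P e then 0 else (1::real))" by auto
  then show ?thesis
    using semilinear_if[OF assms semilinear_zero semilinear_one] by (simp add: semilinear_pred_def)
qed

lemma semilinear_pred_conj:
  assumes "semilinear_pred V P" "semilinear_pred V Q"
  shows "semilinear_pred V (\<lambda>e. P e \<and> Q e)"
proof -
  have "(\<lambda>e. of_bool (P e \<and> Q e)) = (\<lambda>e. if P e then of_bool (Q e) else (0::real))"
    by auto
  then show ?thesis
    using semilinear_if[OF assms(1) assms(2)[unfolded semilinear_pred_def] semilinear_zero]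
    by (simp add: semilinear_pred_def)
qed

lemma semilinear_pred_eq:
  assumes "F \<in> semilinear V" "G \<in> semilinear V"
  shows "semilinear_pred V (\<lambda>e. F e = G e)"
  using semilinear_pred_conj[OF semilinear_pred_not[OF semilinear_pred_less[OF assms]]
      semilinear_pred_not[OF semilinear_pred_less[OF assms(2,1)]]]
  by (simp add: semilinear_pred_def not_less eq_iff conj_commute)

lemma semilinear_pred_ball:
  assumes "finite A" "\<And>x. x \<in> A \<Longrightarrow> semilinear_pred V (P x)"
  shows "semilinear_pred V (\<lambda>e. \<forall>x\<in>A. P x e)"
  using assms by (induction A) (auto simp: semilinear_pred_const semilinear_pred_conj)

lemma semilinear_pred_bex:
  assumes "finite A" "\<And>x. x \<in> A \<Longrightarrow> semilinear_pred V (P x)"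
  shows "semilinear_pred V (\<lambda>e. \<exists>x\<in>A. P x e)"
  using semilinear_pred_not[OF semilinear_pred_ball[of A V "\<lambda>x e. \<not> P x e"]] assms
  by (simp add: semilinear_pred_not)

section \<open>Expressing semilinear functions in the two description languages\<close>

lemma sexp_represents_semilinear:
  assumes "F \<in> semilinear {..<m}"
  shows "\<exists>s. sexp_ok m s \<and> (\<forall>x. sexp_fun s x = F ((!) x))"
  using assms
proof (induction rule: semilinear.induct)
  case (semilinear_var c)
  then show ?case by (intro exI[of _ "SVar c"]) (auto simp: sexp_ok_def)
next
  case semilinear_zero
  show ?case by (intro exI[of _ "SConst 0"]) (auto simp: sexp_ok_def)
next
  case semilinear_one
  show ?case by (intro exI[of _ "SConst 1"]) (auto simp: sexp_ok_def)
next
  case (semilinear_add F G)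
  then obtain s t where "sexp_ok m s" "\<And>x. sexp_fun s x = F ((!) x)"
    "sexp_ok m t" "\<And>x. sexp_fun t x = G ((!) x)" by blast
  then show ?case by (intro exI[of _ "SAdd s t"]) (auto simp: sexp_ok_def)
next
  case (semilinear_minus F)
  then obtain s where "sexp_ok m s" "\<And>x. sexp_fun s x = F ((!) x)" by blast
  then show ?case by (intro exI[of _ "SScale (- 1) s"]) (auto simp: sexp_ok_def of_rat_minus)
next
  case (semilinear_ifPos F G H)
  then obtain s t u where "sexp_ok m s" "\<And>x. sexp_fun s x = F ((!) x)"
    "sexp_ok m t" "\<And>x. sexp_fun t x = G ((!) x)"
    "sexp_ok m u" "\<And>x. sexp_fun u x = H ((!) x)" by blast
  then show ?case by (intro exI[of _ "SIfPos s t u"]) (auto simp: sexp_ok_def)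
qed

text \<open>Intermediate values are named by quantified variables above \<open>r\<close>. Letting
  \<open>r\<close> vary in the induction keeps them apart from the arguments, the result and one
  another.\<close>

lemma fo_form_defines_semilinear:
  assumes "F \<in> semilinear {..<m}" "m \<le> r"
  shows "\<exists>\<phi>. free_vars \<phi> \<subseteq> insert r {..<m} \<and> (\<forall>e. sat e \<phi> \<longleftrightarrow> e r = F e)"
  using assms
proof (induction arbitrary: r rule: semilinear.induct)
  case (semilinear_var c)
  then show ?case by (intro exI[of _ "FEq (TVar r) (TVar c)"]) auto
next
  case semilinear_zero
  show ?case by (intro exI[of _ "FEq (TVar r) TZero"]) auto
next
  case semilinear_one
  show ?case by (intro exI[of _ "FEq (TVar r) TOne"]) auto
next
  case (semilinear_add F G)
  obtain \<phi> where \<phi>: "free_vars \<phi> \<subseteq> insert (Suc r) {..<m}" "\<And>e. sat e \<phi> \<longleftrightarrow> e (Suc r) = F e"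
    using semilinear_add.IH(1)[of "Suc r"] semilinear_add.prems by auto
  obtain \<psi> where \<psi>: "free_vars \<psi> \<subseteq> insert (Suc (Suc r)) {..<m}"
    "\<And>e. sat e \<psi> \<longleftrightarrow> e (Suc (Suc r)) = G e"
    using semilinear_add.IH(2)[of "Suc (Suc r)"] semilinear_add.prems by auto
  have "F (e(Suc r := a, Suc (Suc r) := b)) = F e" "G (e(Suc r := a, Suc (Suc r) := b)) = G e"
    for e a b
    using semilinear_add.prems
    by (auto intro!: semilinear_depends[OF semilinear_add.hyps(1)]
        semilinear_depends[OF semilinear_add.hyps(2)])
  with \<phi> \<psi> show ?case
    by (intro exI[of _ "FEx (Suc r) (FEx (Suc (Suc r)) (FAnd (FAnd \<phi> \<psi>)
          (FEq (TVar r) (TPlus (TVar (Suc r)) (TVar (Suc (Suc r)))))))"]) auto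
next
  case (semilinear_minus F)
  obtain \<phi> where \<phi>: "free_vars \<phi> \<subseteq> insert (Suc r) {..<m}" "\<And>e. sat e \<phi> \<longleftrightarrow> e (Suc r) = F e"
    using semilinear_minus.IH[of "Suc r"] semilinear_minus.prems by auto
  have "F (e(Suc r := a)) = F e" for e a
    using semilinear_minus.prems
    by (auto intro!: semilinear_depends[OF semilinear_minus.hyps(1)])
  with \<phi> show ?case
    by (intro exI[of _ "FEx (Suc r) (FAnd \<phi> (FEq (TPlus (TVar r) (TVar (Suc r))) TZero))"])
      (auto simp: add_eq_0_iff2)
next
  case (semilinear_ifPos F G H)
  obtain \<phi> where \<phi>: "free_vars \<phi> \<subseteq> insert (Suc r) {..<m}" "\<And>e. sat e \<phi> \<longleftrightarrow> e (Suc r) = F e"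
    using semilinear_ifPos.IH(1)[of "Suc r"] semilinear_ifPos.prems by auto
  obtain \<psi> where \<psi>: "free_vars \<psi> \<subseteq> insert r {..<m}" "\<And>e. sat e \<psi> \<longleftrightarrow> e r = G e"
    using semilinear_ifPos.IH(2)[of r] semilinear_ifPos.prems by auto
  obtain \<chi> where \<chi>: "free_vars \<chi> \<subseteq> insert r {..<m}" "\<And>e. sat e \<chi> \<longleftrightarrow> e r = H e"
    using semilinear_ifPos.IH(3)[of r] semilinear_ifPos.prems by auto
  have "F (e(Suc r := a)) = F e" "G (e(Suc r := a)) = G e" "H (e(Suc r := a)) = H e" for e a
    using semilinear_ifPos.prems
    by (auto intro!: semilinear_depends[OF semilinear_ifPos.hyps(1)]
        semilinear_depends[OF semilinear_ifPos.hyps(2)]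
        semilinear_depends[OF semilinear_ifPos.hyps(3)])
  \<comment> \<open>The two negated conjunctions are implications, one for each sign of the
    condition. Both branches may use the result variable \<open>r\<close>, since only one of them
    constrains it.\<close>
  with \<phi> \<psi> \<chi> show ?case
    by (intro exI[of _ "FEx (Suc r) (FAnd \<phi>
          (FAnd (FNot (FAnd (FLess TZero (TVar (Suc r))) (FNot \<psi>)))
            (FNot (FAnd (FNot (FLess TZero (TVar (Suc r)))) (FNot \<chi>)))))"]) auto
qed

lemma fo_fun_eqI:
  assumes "free_vars \<phi> \<subseteq> {..m}"
    and "\<And>x y. length x = m \<Longrightarrow> sat ((!) (x @ [y])) \<phi> \<longleftrightarrow> y = h x"
  shows "fo_ok m \<phi> \<and> (\<forall>x. length x = m \<longrightarrow> fo_fun \<phi> x = h x)"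
  using assms unfolding fo_ok_def fo_fun_def by auto

lemma fo_form_represents_semilinear:
  assumes F: "F \<in> semilinear {..<m}"
  shows "\<exists>\<phi>. fo_ok m \<phi> \<and> (\<forall>x. length x = m \<longrightarrow> fo_fun \<phi> x = F ((!) x))"
proof -
  obtain \<phi> where \<phi>: "free_vars \<phi> \<subseteq> insert m {..<m}" "\<And>e. sat e \<phi> \<longleftrightarrow> e m = F e"
    using fo_form_defines_semilinear[OF F order_refl] by blast
  have "fo_ok m \<phi> \<and> (\<forall>x. length x = m \<longrightarrow> fo_fun \<phi> x = F ((!) x))"
  proof (rule fo_fun_eqI)
    show "free_vars \<phi> \<subseteq> {..m}" using \<phi>(1) by auto
    fix x :: vec and y assume x: "length x = m"
    then have "F ((!) (x @ [y])) = F ((!) x)"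
      by (intro semilinear_depends[OF F]) (auto simp: nth_append)
    then show "sat ((!) (x @ [y])) \<phi> \<longleftrightarrow> y = F ((!) x)"
      using x by (simp add: \<phi>(2) nth_append)
  qed
  then show ?thesis ..
qed

section \<open>Layers with named coordinates\<close>

text \<open>\<open>Own\<close> and \<open>Agg\<close> name the two halves of the vector passed to a
  combination function: the coordinates of the node itself and the maxima over its
  neighbors.\<close>

datatype 'c side = Own 'c | Agg 'c

definition nbrs :: "'v graph \<Rightarrow> 'v \<Rightarrow> 'v set" where
  "nbrs G u = {v. (u, v) \<in> edges G}"

definition max0 :: "'v set \<Rightarrow> ('v \<Rightarrow> real) \<Rightarrow> real" where
  "max0 N f = (if N = {} then 0 else Max (f ` N))"

definition layer_step ::
  "'v graph \<Rightarrow> ('c \<Rightarrow> ('c side \<Rightarrow> real) \<Rightarrow> real) \<Rightarrow> ('v \<Rightarrow> 'c \<Rightarrow> real) \<Rightarrow> 'v \<Rightarrow> 'c \<Rightarrow> real" where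
  "layer_step G e st u c = e c (case_side (st u) (\<lambda>c'. max0 (nbrs G u) (\<lambda>v. st v c')))"

lemma finite_nbrs: "is_graph n G \<Longrightarrow> finite (nbrs G u)"
  unfolding is_graph_def nbrs_def
  by (rule finite_subset[of _ "verts G"]) auto

lemma nbrs_verts: "is_graph n G \<Longrightarrow> v \<in> nbrs G u \<Longrightarrow> v \<in> verts G"
  unfolding is_graph_def nbrs_def by auto

lemma max_agg_nbrs:
  assumes G: "is_graph n G" and emb: "\<And>v. v \<in> verts G \<Longrightarrow> emb v = map (st v) ns"
  shows "max_agg (length ns) {# emb v. v \<in># mset_set {v. (u, v) \<in> edges G} #}
    = map (\<lambda>c. max0 (nbrs G u) (\<lambda>v. st v c)) ns"
proof (rule nth_equalityI)
  fix j assume "j < length (max_agg (length ns) {# emb v. v \<in># mset_set {v. (u, v) \<in> edges G} #})"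
  then have j: "j < length ns" by (simp add: max_agg_def)
  have "(\<lambda>x. x ! j) ` emb ` nbrs G u = (\<lambda>v. st v (ns ! j)) ` nbrs G u"
    using j by (auto simp: emb nbrs_verts[OF G] image_image intro!: image_cong)
  with j finite_nbrs[OF G, of u]
  show "max_agg (length ns) {# emb v. v \<in># mset_set {v. (u, v) \<in> edges G} #} ! j
    = map (\<lambda>c. max0 (nbrs G u) (\<lambda>v. st v c)) ns ! j"
    by (auto simp: max_agg_def max0_def nbrs_def mset_set_empty_iff)
qed (simp add: max_agg_def)

text \<open>Both description languages enter the construction of networks only through this
  property, so the reduction is carried out once for both.\<close>

locale layer_description =
  fixes ok :: "nat \<Rightarrow> 'd \<Rightarrow> bool" and sem :: "'d \<Rightarrow> vec \<Rightarrow> real"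
  assumes represents_semilinear:
    "F \<in> semilinear {..<m} \<Longrightarrow> \<exists>d. ok m d \<and> (\<forall>x. length x = m \<longrightarrow> sem d x = F ((!) x))"
begin

lemma coordinate_exists:
  assumes F: "F \<in> semilinear (Own ` set ns \<union> Agg ` set ns)"
  shows "\<exists>d. ok (2 * length ns) d \<and>
    (\<forall>f g. sem d (map f ns @ map g ns) = F (case_side f g))"
proof -
  \<comment> \<open>\<open>ns\<close> may repeat a name, so some position of each is chosen;
    \<open>\<rho>\<close> then sends \<open>Own\<close> to the first half of the input vector and
    \<open>Agg\<close> to the second.\<close>
  define ix where "ix c = (SOME i. i < length ns \<and> ns ! i = c)" for c
  have ix: "ix c < length ns" "ns ! ix c = c" if "c \<in> set ns" for c
    using someI_ex[of "\<lambda>i. i < length ns \<and> ns ! i = c"] that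
    unfolding ix_def in_set_conv_nth by auto
  define \<rho> where "\<rho> = case_side ix (\<lambda>c. length ns + ix c)"
  have "(\<lambda>e. F (\<lambda>c. e (\<rho> c))) \<in> semilinear {..<2 * length ns}"
    by (rule semilinear_rename[OF F]) (auto simp: \<rho>_def dest: ix(1))
  then obtain d where d: "ok (2 * length ns) d"
    "\<And>x. length x = 2 * length ns \<Longrightarrow> sem d x = F (\<lambda>c. x ! \<rho> c)"
    using represents_semilinear by blast
  have "sem d (map f ns @ map g ns) = F (case_side f g)" for f g
    by (subst d(2)) (auto intro!: semilinear_depends[OF F] simp: \<rho>_def nth_append ix)
  with d(1) show ?thesis by blast
qed

definition layer_implements ::
  "'d list \<Rightarrow> 'c list \<Rightarrow> ('c \<Rightarrow> ('c side \<Rightarrow> real) \<Rightarrow> real) \<Rightarrow> 'c list \<Rightarrow> bool" where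
  "layer_implements ds ns e ns' \<longleftrightarrow>
    length ds = length ns' \<and> (\<forall>d\<in>set ds. ok (2 * length ns) d) \<and>
    (\<forall>n (G :: nat graph) emb st u. is_graph n G \<longrightarrow> (\<forall>v\<in>verts G. emb v = map (st v) ns) \<longrightarrow>
      u \<in> verts G \<longrightarrow>
      map (\<lambda>d. sem d (emb u @ max_agg (length ns)
          {# emb v. v \<in># mset_set {v. (u, v) \<in> edges G} #})) ds = map (layer_step G e st u) ns')"

lemma layer_exists:
  assumes "\<And>c. c \<in> set ns' \<Longrightarrow> e c \<in> semilinear (Own ` set ns \<union> Agg ` set ns)"
  shows "\<exists>ds. layer_implements ds ns e ns'"
proof -
  have "\<forall>c\<in>set ns'. \<exists>d. ok (2 * length ns) d \<and>
      (\<forall>f g. sem d (map f ns @ map g ns) = e c (case_side f g))"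
    using coordinate_exists assms by blast
  then obtain D where D: "\<And>c. c \<in> set ns' \<Longrightarrow> ok (2 * length ns) (D c)"
    "\<And>c f g. c \<in> set ns' \<Longrightarrow> sem (D c) (map f ns @ map g ns) = e c (case_side f g)"
    by metis
  have "sem (D c) (emb u @ max_agg (length ns) {# emb v. v \<in># mset_set {v. (u, v) \<in> edges G} #})
      = layer_step G e st u c"
    if "is_graph n G" "\<forall>v\<in>verts G. emb v = map (st v) ns" "u \<in> verts G" "c \<in> set ns'"
    for n and G :: "nat graph" and emb st u c
    using that max_agg_nbrs[of n G emb st ns u] by (simp add: layer_step_def D)
  then have "layer_implements (map D ns') ns e ns'"
    by (auto simp: layer_implements_def D)
  then show ?thesis ..
qed

definition gnn_implements ::
  "'d list list \<Rightarrow> 'c list \<Rightarrow> ('c \<Rightarrow> ('c side \<Rightarrow> real) \<Rightarrow> real) list \<Rightarrow> 'c \<Rightarrow> bool" where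
  "gnn_implements ls ns es out \<longleftrightarrow> wf_descr ok (length ns) ls \<and>
    (\<forall>n (G :: nat graph) emb st u. is_graph n G \<longrightarrow> (\<forall>v\<in>verts G. emb v = map (st v) ns) \<longrightarrow>
      u \<in> verts G \<longrightarrow>
      run G (localmax_gnn sem (length ns) ls) emb u = [fold (layer_step G) es st u out])"

lemma gnn_implements_Cons:
  assumes ds: "layer_implements ds ns e ns'" and ls: "gnn_implements ls ns' es out"
  shows "gnn_implements (ds # ls) ns (e # es) out"
  unfolding gnn_implements_def
proof (intro conjI allI impI)
  have len: "length ds = length ns'" using ds by (simp add: layer_implements_def)
  show "wf_descr ok (length ns) (ds # ls)"
    using ds ls by (simp add: layer_implements_def gnn_implements_def)
  fix n and G :: "nat graph" and emb :: "nat \<Rightarrow> vec" and st u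
  assume G: "is_graph n G" and emb: "\<forall>v\<in>verts G. emb v = map (st v) ns" and u: "u \<in> verts G"
  define emb' where "emb' w = map (\<lambda>d. sem d (emb w @ max_agg (length ns)
      {# emb v. v \<in># mset_set {v. (w, v) \<in> edges G} #})) ds" for w
  have "\<forall>v\<in>verts G. emb' v = map (layer_step G e st v) ns'"
    using conjunct2[OF conjunct2[OF ds[unfolded layer_implements_def]],
        rule_format, OF G, of emb st] emb
    unfolding emb'_def by simp
  then have "run G (localmax_gnn sem (length ns') ls) emb' u
      = [fold (layer_step G) es (layer_step G e st) u out]"
    using conjunct2[OF ls[unfolded gnn_implements_def], rule_format, OF G] u by simp
  then show "run G (localmax_gnn sem (length ns) (ds # ls)) emb u
      = [fold (layer_step G) (e # es) st u out]"
    by (simp add: len emb'_def[abs_def])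
qed

text \<open>The lists of coordinates are found backwards: the last one is \<open>[out]\<close>, and
  each earlier one collects the finitely many names that the next layer reads to compute its own
  list.\<close>

lemma gnn_exists:
  assumes "\<And>e c. e \<in> set es \<Longrightarrow> e c \<in> semilinear UNIV"
  shows "\<exists>ls ns. gnn_implements ls ns es out"
  using assms
proof (induction es)
  case Nil
  have "gnn_implements [] [out] [] out" by (simp add: gnn_implements_def)
  then show ?case by blast
next
  case (Cons e es)
  then obtain ls ns' where ls: "gnn_implements ls ns' es out" by auto
  have "\<forall>c. \<exists>W. finite W \<and> e c \<in> semilinear W"
    using Cons.prems semilinear_finite_support by (metis list.set_intros(1))
  then obtain W where W: "\<And>c. finite (W c)" "\<And>c. e c \<in> semilinear (W c)" by metis
  have "finite (case_side id id ` (\<Union>c\<in>set ns'. W c))" using W(1) by simp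
  from finite_list[OF this] obtain ns where ns: "set ns = case_side id id ` (\<Union>c\<in>set ns'. W c)" ..
  have "e c \<in> semilinear (Own ` set ns \<union> Agg ` set ns)" if c: "c \<in> set ns'" for c
  proof (rule semilinear_mono[OF W(2)], rule subsetI)
    fix s assume "s \<in> W c"
    with c have "case_side id id s \<in> set ns" unfolding ns by blast
    then show "s \<in> Own ` set ns \<union> Agg ` set ns" by (cases s) auto
  qed
  from layer_exists[OF this] obtain ds where "layer_implements ds ns e ns'" ..
  from gnn_implements_Cons[OF this ls] show ?case by (intro exI)
qed

end

section \<open>Horn clauses\<close>

datatype hterm = HZero | HVar nat | HSuc nat

type_synonym 'p atom = "'p \<times> hterm list"
type_synonym 'p clause = "'p atom \<times> 'p atom list"

text \<open>Evaluation is needed over two domains: derivations obtained from computations are over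
  \<open>nat\<close>, while the registers of an arbitrary keyed graph only give reals.\<close>

fun hval :: "(nat \<Rightarrow> 'a::semiring_1) \<Rightarrow> hterm \<Rightarrow> 'a" where
  "hval a HZero = 0"
| "hval a (HVar j) = a j"
| "hval a (HSuc j) = a j + 1"

definition inst :: "(nat \<Rightarrow> 'a::semiring_1) \<Rightarrow> 'p atom \<Rightarrow> 'p \<times> 'a list" where
  "inst a b = (fst b, map (hval a) (snd b))"

lemma inst_Pair [simp]: "inst a (q, ts) = (q, map (hval a) ts)"
  by (simp add: inst_def)

text \<open>Variables range over the elements above \<open>- 1\<close>, written so that the definition also makes
  sense, with a void condition, for natural numbers.\<close>

inductive derivable :: "'p clause set \<Rightarrow> 'p \<times> 'a::linordered_semidom list \<Rightarrow> bool" for C where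
  derivableI: "(h, bs) \<in> C \<Longrightarrow> (\<And>j. 0 < a j + 1) \<Longrightarrow>
    (\<And>b. b \<in> set bs \<Longrightarrow> derivable C (inst a b)) \<Longrightarrow> derivable C (inst a h)"

section \<open>A Horn program describing partial recursive functions\<close>

datatype pred = Root recf | Main recf | Slot nat recf | Below recf

definition hvars :: "nat \<Rightarrow> nat \<Rightarrow> hterm list" where
  "hvars i r = map HVar [i..<i + r]"

text \<open>In the clause for a composition the premises need pairwise different predicates, even if the
  same function occurs several times; this is what \<open>Slot\<close> is for.\<close>

definition slot_clause :: "nat \<Rightarrow> recf \<Rightarrow> nat \<Rightarrow> pred clause" where
  "slot_clause j f r = ((Slot j f, hvars 0 (Suc r)), [(Main f, hvars 0 (Suc r))])"

text \<open>\<open>r\<close> is the arity. \<open>Main f\<close> takes the inputs followed by the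
  output; \<open>Below f\<close> says that \<open>f\<close> is positive at all smaller first
  arguments. In \<open>PrimRec\<close>, variables 0, 1 and 2 stand for the counter, the recursive
  value and the result, with parameters from 3 on; in \<open>Mu\<close>, 0 is the counter, 1 the
  predecessor of a positive value, and inputs start at 2.\<close>

fun clauses :: "recf \<Rightarrow> nat \<Rightarrow> pred clause list" where
  "clauses Zero r = [((Main Zero, hvars 0 r @ [HZero]), [])]"
| "clauses Succ r = [((Main Succ, [HVar 0, HSuc 0]), [])]"
| "clauses (Proj i) r = (if i < r then [((Main (Proj i), hvars 0 r @ [HVar i]), [])] else [])"
| "clauses (Comp f gs) r =
    ((Main (Comp f gs), hvars 0 r @ [HVar (r + length gs)]),
      (Slot 0 f, hvars r (length gs) @ [HVar (r + length gs)]) #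
      map (\<lambda>j. (Slot (Suc j) (gs ! j), hvars 0 r @ [HVar (r + j)])) [0..<length gs]) #
    slot_clause 0 f (length gs) #
    map (\<lambda>j. slot_clause (Suc j) (gs ! j) r) [0..<length gs] @
    clauses f (length gs) @ concat (map (\<lambda>g. clauses g r) gs)"
| "clauses (PrimRec f g) r =
    ((Main (PrimRec f g), HZero # hvars 3 (r - 1) @ [HVar 2]), [(Main f, hvars 3 (r - 1) @ [HVar 2])]) #
    ((Main (PrimRec f g), HSuc 0 # hvars 3 (r - 1) @ [HVar 2]),
      [(Main (PrimRec f g), HVar 0 # hvars 3 (r - 1) @ [HVar 1]),
       (Main g, HVar 0 # HVar 1 # hvars 3 (r - 1) @ [HVar 2])]) #
    clauses f (r - 1) @ clauses g (Suc r)"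
| "clauses (Mu f) r =
    ((Below f, HZero # hvars 2 r), []) #
    ((Below f, HSuc 0 # hvars 2 r),
      [(Below f, HVar 0 # hvars 2 r), (Main f, HVar 0 # hvars 2 r @ [HSuc 1])]) #
    ((Main (Mu f), hvars 2 r @ [HVar 0]),
      [(Below f, HVar 0 # hvars 2 r), (Main f, HVar 0 # hvars 2 r @ [HZero])]) #
    clauses f (Suc r)"

definition root_clause :: "recf \<Rightarrow> pred clause" where
  "root_clause g = ((Root g, [HVar 0]), [(Main g, [HVar 0, HSuc 1])])"

text \<open>Premises with different predicates come from different clauses, hence have different
  node types; this lets a cell find each premise as its only neighbor of a type. In the recursion
  step, \<open>PrimRec f g\<close> differs from \<open>g\<close> by size.\<close>

lemma distinct_body_clauses:
  "(h, bs) \<in> set (clauses f r) \<Longrightarrow> distinct (map fst bs)"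
proof (induction f r arbitrary: h bs rule: clauses.induct)
  case (4 f gs r)
  have "distinct (map fst ((Slot 0 f, hvars r (length gs) @ [HVar (r + length gs)]) #
      map (\<lambda>j. (Slot (Suc j) (gs ! j), hvars 0 r @ [HVar (r + j)])) [0..<length gs]))"
    by (auto simp: o_def distinct_map inj_on_def)
  with "4.prems" show ?case by (auto simp: slot_clause_def intro: "4.IH")
next
  case (5 f g r)
  have "PrimRec f g \<noteq> g"
    by (auto dest: arg_cong[of _ _ size])
  with "5.prems" show ?case by (auto intro: "5.IH")
next
  case (6 f r)
  from "6.prems" show ?case by (auto intro: "6.IH")
qed (auto split: if_splits)

subsection \<open>Derivable facts hold\<close>

text \<open>Arguments that are inputs of a function are assumed to be natural numbers, whereas outputs
  turn out to be natural numbers.\<close>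

fun holds :: "pred \<times> real list \<Rightarrow> bool" where
  "holds (Root g, zs) \<longleftrightarrow> (\<forall>x. zs = [real x] \<longrightarrow> (\<exists>y. computes g [x] (Suc y)))"
| "holds (Main f, zs) \<longleftrightarrow> (\<forall>xs z. zs = map real xs @ [z] \<longrightarrow> (\<exists>y. z = real y \<and> computes f xs y))"
| "holds (Slot j f, zs) \<longleftrightarrow> (\<forall>xs z. zs = map real xs @ [z] \<longrightarrow> (\<exists>y. z = real y \<and> computes f xs y))"
| "holds (Below f, zs) \<longleftrightarrow> (\<forall>z xs. zs = z # map real xs \<longrightarrow>
     (\<exists>m. z = real m \<and> (\<forall>k<m. \<exists>y. computes f (k # xs) (Suc y))))"

definition sound_clause :: "pred clause \<Rightarrow> bool" where
  "sound_clause c \<longleftrightarrow> (\<forall>a. (\<forall>j. 0 < a j + 1) \<longrightarrow> (\<forall>b\<in>set (snd c). holds (inst a b)) \<longrightarrow>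
     holds (inst a (fst c)))"

lemma sound_clauseI:
  assumes "\<And>a :: nat \<Rightarrow> real. (\<And>j. 0 < a j + 1) \<Longrightarrow> (\<And>b. b \<in> set bs \<Longrightarrow> holds (inst a b)) \<Longrightarrow>
    holds (inst a h)"
  shows "sound_clause (h, bs)"
  using assms unfolding sound_clause_def by simp

lemma derivable_holds:
  assumes "derivable C x" "\<And>c. c \<in> C \<Longrightarrow> sound_clause c"
  shows "holds x"
  using assms(1)
proof (induction rule: derivable.induct)
  case (derivableI h bs a)
  then show ?case using assms(2)[OF derivableI(1)] unfolding sound_clause_def by auto
qed

text \<open>The case \<open>m = 0\<close> would force \<open>z = - 1\<close>. This is the point of
  the bound on variables: predecessors of natural numbers are recognized as natural.\<close>

lemma natural_of_gt_minus_one: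
  assumes "z + 1 = real m" "0 < z + 1" shows "\<exists>k. m = Suc k \<and> z = real k"
  using assms by (cases m) auto

lemma sound_slot_clause: "sound_clause (slot_clause j f r)"
  unfolding slot_clause_def by (rule sound_clauseI) simp

text \<open>Naturalness flows in the order of computation: the counter is the predecessor of an
  input, then the recursive value is an output, and then both are legitimate inputs of
  \<open>g\<close>.\<close>

lemma sound_clauses_PrimRec:
  "sound_clause ((Main (PrimRec f g), HZero # ts @ [HVar 2]), [(Main f, ts @ [HVar 2])])"
  "sound_clause ((Main (PrimRec f g), HSuc 0 # ts @ [HVar 2]),
      [(Main (PrimRec f g), HVar 0 # ts @ [HVar 1]), (Main g, HVar 0 # HVar 1 # ts @ [HVar 2])])"
proof -
  show "sound_clause ((Main (PrimRec f g), HZero # ts @ [HVar 2]), [(Main f, ts @ [HVar 2])])"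
    by (rule sound_clauseI) (fastforce simp: Cons_eq_append_conv map_eq_Cons_conv Cons_eq_map_conv intro: computes.prim_0)
  show "sound_clause ((Main (PrimRec f g), HSuc 0 # ts @ [HVar 2]),
      [(Main (PrimRec f g), HVar 0 # ts @ [HVar 1]), (Main g, HVar 0 # HVar 1 # ts @ [HVar 2])])"
  proof (rule sound_clauseI)
    fix a :: "nat \<Rightarrow> real"
    assume pos: "\<And>j. 0 < a j + 1"
      and prems: "\<And>b. b \<in> set [(Main (PrimRec f g), HVar 0 # ts @ [HVar 1]),
        (Main g, HVar 0 # HVar 1 # ts @ [HVar 2])] \<Longrightarrow> holds (inst a b)"
    show "holds (inst a (Main (PrimRec f g), HSuc 0 # ts @ [HVar 2]))"
      unfolding inst_Pair holds.simps
    proof (intro allI impI)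
      fix xs z assume eq: "map (hval a) (HSuc 0 # ts @ [HVar 2]) = map real xs @ [z]"
      then obtain m xs' where xs: "xs = m # xs'" by (cases xs) auto
      with eq have m: "a 0 + 1 = real m" and ts: "map (hval a) ts = map real xs'" and z: "z = a 2"
        by auto
      from natural_of_gt_minus_one[OF m pos] obtain k where k: "m = Suc k" "a 0 = real k" by blast
      have "\<exists>r. a 1 = real r \<and> computes (PrimRec f g) (k # xs') r"
        using prems[of "(Main (PrimRec f g), HVar 0 # ts @ [HVar 1])"] k ts
        by (auto dest: spec[of _ "k # xs'"])
      then obtain r where r: "a 1 = real r" "computes (PrimRec f g) (k # xs') r" by blast
      have "\<exists>y. z = real y \<and> computes g (k # r # xs') y"
        using prems[of "(Main g, HVar 0 # HVar 1 # ts @ [HVar 2])"] k ts r z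
        by (auto dest: spec[of _ "k # r # xs'"])
      then show "\<exists>y. z = real y \<and> computes (PrimRec f g) xs y"
        using r(2) xs k by (blast intro: computes.prim_Suc)
    qed
  qed
qed

lemma sound_clauses_Mu:
  "sound_clause ((Below f, HZero # ts), [])"
  "sound_clause ((Below f, HSuc 0 # ts),
      [(Below f, HVar 0 # ts), (Main f, HVar 0 # ts @ [HSuc 1])])"
  "sound_clause ((Main (Mu f), ts @ [HVar 0]),
      [(Below f, HVar 0 # ts), (Main f, HVar 0 # ts @ [HZero])])"
proof -
  show "sound_clause ((Below f, HZero # ts), [])"
    by (rule sound_clauseI) auto
  show "sound_clause ((Below f, HSuc 0 # ts),
      [(Below f, HVar 0 # ts), (Main f, HVar 0 # ts @ [HSuc 1])])"
  proof (rule sound_clauseI)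
    fix a :: "nat \<Rightarrow> real"
    assume pos: "\<And>j. 0 < a j + 1"
      and prems: "\<And>b. b \<in> set [(Below f, HVar 0 # ts), (Main f, HVar 0 # ts @ [HSuc 1])] \<Longrightarrow>
        holds (inst a b)"
    show "holds (inst a (Below f, HSuc 0 # ts))"
      unfolding inst_Pair holds.simps
    proof (intro allI impI)
      fix z xs assume eq: "map (hval a) (HSuc 0 # ts) = z # map real xs"
      then obtain m where m: "a 0 = real m" "\<forall>k<m. \<exists>y. computes f (k # xs) (Suc y)"
        using prems[of "(Below f, HVar 0 # ts)"] by auto
      have "\<exists>y. a 1 + 1 = real y \<and> computes f (m # xs) y"
        using prems[of "(Main f, HVar 0 # ts @ [HSuc 1])"] m(1) eq
        by (auto dest: spec[of _ "m # xs"])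
      \<comment> \<open>The value of \<open>f\<close> at \<open>m\<close> is \<open>a 1 + 1\<close>
        with \<open>a 1\<close> above -1, so it is a positive natural number.\<close>
      then obtain y where "computes f (m # xs) (Suc y)"
        using natural_of_gt_minus_one pos by metis
      with m eq show "\<exists>m. z = real m \<and> (\<forall>k<m. \<exists>y. computes f (k # xs) (Suc y))"
        by (intro exI[of _ "Suc m"]) (auto simp: less_Suc_eq)
    qed
  qed
  show "sound_clause ((Main (Mu f), ts @ [HVar 0]),
      [(Below f, HVar 0 # ts), (Main f, HVar 0 # ts @ [HZero])])"
  proof (rule sound_clauseI)
    fix a :: "nat \<Rightarrow> real"
    assume prems: "\<And>b. b \<in> set [(Below f, HVar 0 # ts), (Main f, HVar 0 # ts @ [HZero])] \<Longrightarrow>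
        holds (inst a b)"
    show "holds (inst a (Main (Mu f), ts @ [HVar 0]))"
      unfolding inst_Pair holds.simps
    proof (intro allI impI)
      fix xs z assume eq: "map (hval a) (ts @ [HVar 0]) = map real xs @ [z]"
      then obtain m where m: "a 0 = real m" "\<forall>k<m. \<exists>y. computes f (k # xs) (Suc y)"
        using prems[of "(Below f, HVar 0 # ts)"] by auto
      have "computes f (m # xs) 0"
        using prems[of "(Main f, HVar 0 # ts @ [HZero])"] m(1) eq
        by (auto dest: spec[of _ "m # xs"])
      with m eq show "\<exists>y. z = real y \<and> computes (Mu f) xs y"
        by (intro exI[of _ m]) (auto intro: computes.mu)
    qed
  qed
qed

lemma sound_clause_Comp:
  assumes "length vs = length gs"
  shows "sound_clause ((Main (Comp f gs), ts @ [t]),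
      (Slot 0 f, vs @ [t]) # map (\<lambda>j. (Slot (Suc j) (gs ! j), ts @ [vs ! j])) [0..<length gs])"
proof (rule sound_clauseI)
  fix a :: "nat \<Rightarrow> real"
  assume prems: "\<And>b. b \<in> set ((Slot 0 f, vs @ [t]) #
      map (\<lambda>j. (Slot (Suc j) (gs ! j), ts @ [vs ! j])) [0..<length gs]) \<Longrightarrow> holds (inst a b)"
  show "holds (inst a (Main (Comp f gs), ts @ [t]))"
    unfolding inst_Pair holds.simps
  proof (intro allI impI)
    fix xs z assume eq: "map (hval a) (ts @ [t]) = map real xs @ [z]"
    have "\<exists>y. hval a (vs ! j) = real y \<and> computes (gs ! j) xs y" if "j < length gs" for j
      using prems[of "(Slot (Suc j) (gs ! j), ts @ [vs ! j])"] that eq by auto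
    then obtain Y where Y: "\<And>j. j < length gs \<Longrightarrow> hval a (vs ! j) = real (Y j)"
      "\<And>j. j < length gs \<Longrightarrow> computes (gs ! j) xs (Y j)" by metis
    define ys where "ys = map Y [0..<length gs]"
    have "list_all2 (\<lambda>g y. computes g xs y) gs ys"
      by (auto simp: list_all2_conv_all_nth ys_def Y)
    moreover have "map (hval a) vs = map real ys"
      using Y(1) assms by (auto intro: nth_equalityI simp: ys_def)
    ultimately show "\<exists>y. z = real y \<and> computes (Comp f gs) xs y"
      using prems[of "(Slot 0 f, vs @ [t])"] eq by (fastforce intro: computes.comp)
  qed
qed

lemma sound_clauses: "c \<in> set (clauses f r) \<Longrightarrow> sound_clause c"
proof (induction f r arbitrary: c rule: clauses.induct)
  case (1 r)
  then show ?case by (auto intro!: sound_clauseI intro: computes.zero)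
next
  case (2 r)
  have "sound_clause ((Main Succ, [HVar 0, HSuc 0]), [])"
  proof (rule sound_clauseI)
    fix a :: "nat \<Rightarrow> real"
    show "holds (inst a (Main Succ, [HVar 0, HSuc 0]))"
      using computes.succ
      by (force simp: Cons_eq_append_conv Cons_eq_map_conv)
  qed
  with 2 show ?case by simp
next
  case (3 i r)
  have "sound_clause ((Main (Proj i), hvars 0 r @ [HVar i]), [])" if "i < r"
  proof (rule sound_clauseI)
    fix a :: "nat \<Rightarrow> real"
    show "holds (inst a (Main (Proj i), hvars 0 r @ [HVar i]))"
      unfolding inst_Pair holds.simps
    proof (intro allI impI)
      fix xs z assume "map (hval a) (hvars 0 r @ [HVar i]) = map real xs @ [z]"
      then have xs: "map a [0..<r] = map real xs" and z: "z = a i"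
        by (auto simp: hvars_def o_def)
      from xs have "length xs = r" by (metis length_map length_upt minus_nat.diff_0)
      moreover from this xs that have "a i = real (xs ! i)"
        by (metis add_0 length_map nth_map nth_upt)
      ultimately show "\<exists>y. z = real y \<and> computes (Proj i) xs y"
        using z that by (auto intro: computes.proj)
    qed
  qed
  with 3 show ?case by (auto split: if_splits)
next
  case (4 f gs r)
  have "sound_clause ((Main (Comp f gs), hvars 0 r @ [HVar (r + length gs)]),
      (Slot 0 f, hvars r (length gs) @ [HVar (r + length gs)]) #
      map (\<lambda>j. (Slot (Suc j) (gs ! j), hvars 0 r @ [HVar (r + j)])) [0..<length gs])"
  proof -
    have eq: "map (\<lambda>j. (Slot (Suc j) (gs ! j), hvars 0 r @ [hvars r (length gs) ! j])) [0..<length gs]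
      = map (\<lambda>j. (Slot (Suc j) (gs ! j), hvars 0 r @ [HVar (r + j)])) [0..<length gs]"
      by (simp add: hvars_def)
    show ?thesis
      using sound_clause_Comp[of "hvars r (length gs)" gs f "hvars 0 r" "HVar (r + length gs)"]
      unfolding eq by (simp add: hvars_def)
  qed
  with "4.prems" show ?case by (auto simp: sound_slot_clause intro: "4.IH")
next
  case (5 f g r)
  from "5.prems" show ?case by (auto intro: sound_clauses_PrimRec[simplified] "5.IH"[simplified])
next
  case (6 f r)
  from "6.prems" show ?case by (auto intro: sound_clauses_Mu[simplified] "6.IH"[simplified])
qed

lemma sound_root_clause: "sound_clause (root_clause g)"
  unfolding root_clause_def
proof (rule sound_clauseI)
  fix a :: "nat \<Rightarrow> real"
  assume pos: "\<And>j. 0 < a j + 1"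
    and prems: "\<And>b. b \<in> set [(Main g, [HVar 0, HSuc 1])] \<Longrightarrow> holds (inst a b)"
  show "holds (inst a (Root g, [HVar 0]))"
    unfolding inst_Pair holds.simps
  proof (intro allI impI)
    fix x assume "map (hval a) [HVar 0] = [real x]"
    then have "\<exists>y. a 1 + 1 = real y \<and> computes g [x] y"
      using prems by (auto dest: spec[of _ "[x]"])
    then show "\<exists>y. computes g [x] (Suc y)"
      using natural_of_gt_minus_one pos by metis
  qed
qed

theorem derivable_Root_imp_computes:
  assumes "derivable (set (clauses g 1 @ [root_clause g])) (Root g, [real x])"
  shows "\<exists>y. computes g [x] (Suc y)"
  using derivable_holds[OF assms] sound_clauses sound_root_clause by fastforce

subsection \<open>Computations are derivable\<close>

lemma derivable_nat:
  fixes a :: "nat \<Rightarrow> nat"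
  assumes "(h, bs) \<in> C" "\<And>b. b \<in> set bs \<Longrightarrow> derivable C (inst a b)" "x = inst a h"
  shows "derivable C x"
  using derivableI[of h bs C a] assms by simp

lemma hval_hvars:
  "length ps = i \<Longrightarrow> length xs = r \<Longrightarrow> map (hval ((!) (ps @ xs @ qs))) (hvars i r) = xs"
  by (rule nth_equalityI) (auto simp: hvars_def nth_append)

lemma hval_hvars_0: "length xs = r \<Longrightarrow> map (hval ((!) (xs @ qs))) (hvars 0 r) = xs"
  using hval_hvars[of "[]" 0] by simp

lemma hval_hvars_2: "length xs = r \<Longrightarrow> map (hval ((!) (x # y # xs))) (hvars 2 r) = xs"
  using hval_hvars[of "[x, y]" 2 xs r "[]"] by simp

lemma hval_hvars_3: "length xs = r \<Longrightarrow> map (hval ((!) (x # y # z # xs))) (hvars 3 r) = xs"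
  using hval_hvars[of "[x, y, z]" 3 xs r "[]"] by simp

lemma derivable_Slot:
  assumes "derivable C (Main f, xs @ [y :: nat])" "slot_clause j f (length xs) \<in> C"
  shows "derivable C (Slot j f, xs @ [y])"
  by (rule derivable_nat[OF assms(2)[unfolded slot_clause_def], where a = "(!) (xs @ [y])"])
    (use assms(1) in \<open>auto simp: hval_hvars_0[of _ _ "[]", simplified]\<close>)

lemma derivable_Below:
  assumes "((Below f, HZero # hvars 2 (length xs)), []) \<in> C"
    "((Below f, HSuc 0 # hvars 2 (length xs)),
      [(Below f, HVar 0 # hvars 2 (length xs)), (Main f, HVar 0 # hvars 2 (length xs) @ [HSuc 1])]) \<in> C"
    "\<And>k. k < m \<Longrightarrow> \<exists>y. derivable C (Main f, k # xs @ [Suc y])"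
  shows "derivable C (Below f, m # xs)"
  using assms(3)
proof (induction m)
  case 0
  show ?case
    by (rule derivable_nat[OF assms(1), where a = "(!) (0 # 0 # xs)"]) (auto simp: hval_hvars_2)
next
  case (Suc m)
  obtain y where "derivable C (Main f, m # xs @ [Suc y])" using Suc.prems[of m] by auto
  moreover have "derivable C (Below f, m # xs)" using Suc by auto
  ultimately show ?case
    by (rule_tac derivable_nat[OF assms(2), where a = "(!) (m # y # xs)"]) (auto simp: hval_hvars_2)
qed

lemma computes_imp_derivable:
  assumes "computes f xs y" "set (clauses f (length xs)) \<subseteq> C"
  shows "derivable C (Main f, xs @ [y])"
  using assms
proof (induction rule: computes.induct)
  case (zero xs)
  then show ?case
    by (rule_tac derivable_nat[where a = "(!) xs" and bs = "[]"
          and h = "(Main Zero, hvars 0 (length xs) @ [HZero])"])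
      (auto simp: hval_hvars_0[of _ _ "[]", simplified])
next
  case (succ x)
  then show ?case
    by (rule_tac derivable_nat[where a = "(!) [x]" and bs = "[]" and h = "(Main Succ, [HVar 0, HSuc 0])"]) auto
next
  case (proj i xs)
  then show ?case
    by (rule_tac derivable_nat[where a = "(!) xs" and bs = "[]"
          and h = "(Main (Proj i), hvars 0 (length xs) @ [HVar i])"])
      (auto simp: hval_hvars_0[of _ _ "[]", simplified])
next
  case (comp xs gs ys f z)
  have len: "length ys = length gs" using comp.IH(1) by (simp add: list_all2_lengthD)
  have C: "set (clauses f (length gs)) \<subseteq> C" "slot_clause 0 f (length gs) \<in> C"
    "\<And>j. j < length gs \<Longrightarrow> set (clauses (gs ! j) (length xs)) \<subseteq> C"
    "\<And>j. j < length gs \<Longrightarrow> slot_clause (Suc j) (gs ! j) (length xs) \<in> C"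
    using comp.prems nth_mem[of _ gs] by (auto simp: UN_subset_iff)
  have "derivable C (Slot 0 f, ys @ [z])"
    using comp.IH(2) C(1,2) len by (auto intro: derivable_Slot)
  moreover have "derivable C (Slot (Suc j) (gs ! j), xs @ [ys ! j])" if "j < length gs" for j
    using comp.IH(1) C(3,4) that by (auto intro!: derivable_Slot simp: list_all2_conv_all_nth)
  moreover have "map (hval ((!) (xs @ ys @ [z]))) (hvars (length xs) (length gs)) = ys"
    by (rule hval_hvars) (auto simp: len)
  ultimately show ?case
    using comp.prems
    by (rule_tac derivable_nat[where a = "(!) (xs @ ys @ [z])"
          and h = "(Main (Comp f gs), hvars 0 (length xs) @ [HVar (length xs + length gs)])"
          and bs = "(Slot 0 f, hvars (length xs) (length gs) @ [HVar (length xs + length gs)]) #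
            map (\<lambda>j. (Slot (Suc j) (gs ! j), hvars 0 (length xs) @ [HVar (length xs + j)]))
              [0..<length gs]"])
      (auto simp: hval_hvars_0 len nth_append)
next
  case (prim_0 f xs y g)
  then show ?case
    by (rule_tac derivable_nat[where a = "(!) (0 # 0 # y # xs)"
          and h = "(Main (PrimRec f g), HZero # hvars 3 (length xs) @ [HVar 2])"
          and bs = "[(Main f, hvars 3 (length xs) @ [HVar 2])]"]) (auto simp: hval_hvars_3)
next
  case (prim_Suc f g m xs r y)
  then have "derivable C (Main (PrimRec f g), m # xs @ [r])" "derivable C (Main g, m # r # xs @ [y])"
    by auto
  then show ?case using prim_Suc.prems
    by (rule_tac derivable_nat[where a = "(!) (m # r # y # xs)"
          and h = "(Main (PrimRec f g), HSuc 0 # hvars 3 (length xs) @ [HVar 2])"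
          and bs = "[(Main (PrimRec f g), HVar 0 # hvars 3 (length xs) @ [HVar 1]),
            (Main g, HVar 0 # HVar 1 # hvars 3 (length xs) @ [HVar 2])]"])
      (auto simp: hval_hvars_3)
next
  case (mu f m xs)
  have "derivable C (Below f, m # xs)"
    by (rule derivable_Below) (use mu in fastforce)+
  moreover have "derivable C (Main f, m # xs @ [0])" using mu by auto
  ultimately show ?case using mu.prems
    by (rule_tac derivable_nat[where a = "(!) (m # 0 # xs)"
          and h = "(Main (Mu f), hvars 2 (length xs) @ [HVar 0])"
          and bs = "[(Below f, HVar 0 # hvars 2 (length xs)),
            (Main f, HVar 0 # hvars 2 (length xs) @ [HZero])]"])
      (auto simp: hval_hvars_2)
qed

section \<open>A graph neural network that checks derivations\<close>

lemma max0_ge: "finite N \<Longrightarrow> v \<in> N \<Longrightarrow> f v \<le> max0 N f"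
  by (auto simp: max0_def)

lemma max0_attained: "finite N \<Longrightarrow> max0 N f \<noteq> 0 \<Longrightarrow> \<exists>v\<in>N. max0 N f = f v"
  using Max_in[of "f ` N"] by (fastforce simp: max0_def split: if_splits)

lemma max0_single:
  assumes "finite N" "w \<in> N" "0 \<le> f w" "\<And>v. v \<in> N \<Longrightarrow> v \<noteq> w \<Longrightarrow> f v = 0"
  shows "max0 N f = f w"
proof -
  have "f v \<le> f w" if "v \<in> N" for v using assms(3,4) that by (cases "v = w") auto
  then have "Max (f ` N) = f w" using assms(1,2) by (intro Max_eqI) auto
  then show ?thesis using assms(2) by (auto simp: max0_def)
qed

lemma max0_nonneg: "finite N \<Longrightarrow> (\<And>v. v \<in> N \<Longrightarrow> 0 \<le> f v) \<Longrightarrow> 0 \<le> max0 N f"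
  by (metis max0_attained order_refl)

text \<open>The open interval leaves out integer keys, so a typed node has a positive fractional
  part; negative keys have no type.\<close>

definition in_type :: "nat \<Rightarrow> real \<Rightarrow> bool" where
  "in_type \<tau> z \<longleftrightarrow> real \<tau> < z \<and> z < real \<tau> + 1"

lemma in_type_unique: "in_type \<tau> z \<Longrightarrow> in_type \<tau>' z \<Longrightarrow> \<tau> = \<tau>'"
  unfolding in_type_def by linarith

definition typed_nbrs :: "'v graph \<Rightarrow> ('v \<Rightarrow> real) \<Rightarrow> 'v \<Rightarrow> nat \<Rightarrow> 'v set" where
  "typed_nbrs G key v \<tau> = {w \<in> nbrs G v. in_type \<tau> (key w)}"

text \<open>The largest fractional part among the neighbors of type \<open>\<tau>\<close>, and 0 if
  there are none; with a unique such neighbor it is the number stored there.\<close>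

definition offset :: "'v graph \<Rightarrow> ('v \<Rightarrow> real) \<Rightarrow> 'v \<Rightarrow> nat \<Rightarrow> real" where
  "offset G key v \<tau> = max0 (nbrs G v) (\<lambda>w. if in_type \<tau> (key w) then key w - \<tau> else 0)"

lemma offset_nonneg: "is_graph n G \<Longrightarrow> 0 \<le> offset G key v \<tau>"
  unfolding offset_def by (rule max0_nonneg) (auto simp: finite_nbrs in_type_def)

lemma offset_attained:
  assumes "is_graph n G" "offset G key v \<tau> \<noteq> 0"
  shows "\<exists>w\<in>typed_nbrs G key v \<tau>. offset G key v \<tau> = key w - \<tau>"
  using max0_attained[OF finite_nbrs[OF assms(1)] assms(2)[unfolded offset_def]] assms(2)
  unfolding typed_nbrs_def offset_def by (auto split: if_splits)

lemma max0_typed_nbr: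
  assumes "is_graph n G" "typed_nbrs G key v \<tau> = {w}" "0 \<le> f w"
  shows "max0 (nbrs G v) (\<lambda>w. if in_type \<tau> (key w) then f w else 0) = f w"
proof -
  have "w \<in> nbrs G v" "in_type \<tau> (key w)"
    using assms(2) unfolding typed_nbrs_def by auto
  moreover have "(if in_type \<tau> (key w') then f w' else 0) = 0" if "w' \<in> nbrs G v" "w' \<noteq> w" for w'
    using assms(2) that unfolding typed_nbrs_def by auto
  ultimately show ?thesis
    using max0_single[OF finite_nbrs[OF assms(1)], of w v "\<lambda>w. if in_type \<tau> (key w) then f w else 0"]
      assms(3) by simp
qed

lemma offset_singleton:
  assumes "is_graph n G" "typed_nbrs G key v \<tau> = {w}"
  shows "offset G key v \<tau> = key w - \<tau>"
proof -
  have "in_type \<tau> (key w)" using assms(2) by (auto simp: typed_nbrs_def)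
  then show ?thesis
    unfolding offset_def by (intro max0_typed_nbr[OF assms]) (simp add: in_type_def)
qed

text \<open>As both maxima are taken over nonnegative numbers, the sum is \<open>2 + max - min\<close> over the
  neighbors of type \<open>\<tau>\<close>, or \<open>0\<close> if there are none.\<close>

lemma unique_typed_nbr_iff:
  assumes G: "is_graph n G" and inj: "is_keying G key"
  shows "offset G key v \<tau> + max0 (nbrs G v) (\<lambda>w. if in_type \<tau> (key w) then 2 - (key w - \<tau>) else 0) = 2
    \<longleftrightarrow> (\<exists>w. typed_nbrs G key v \<tau> = {w})" (is "_ + ?D = 2 \<longleftrightarrow> _")
proof
  note fin = finite_nbrs[OF G, of v]
  assume eq: "offset G key v \<tau> + ?D = 2"
  have up: "key w - \<tau> \<le> offset G key v \<tau>" if "w \<in> typed_nbrs G key v \<tau>" for w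
    using max0_ge[OF fin, of w "\<lambda>w. if in_type \<tau> (key w) then key w - \<tau> else 0"] that
    by (auto simp: typed_nbrs_def offset_def)
  have dn: "2 - (key w - \<tau>) \<le> ?D" if "w \<in> typed_nbrs G key v \<tau>" for w
    using max0_ge[OF fin, of w "\<lambda>w. if in_type \<tau> (key w) then 2 - (key w - \<tau>) else 0"] that
    by (auto simp: typed_nbrs_def)
  have "typed_nbrs G key v \<tau> \<noteq> {}"
  proof
    assume *: "typed_nbrs G key v \<tau> = {}"
    then have "offset G key v \<tau> = 0" using offset_attained[OF G] by fastforce
    moreover have "?D = 0"
      using max0_attained[OF fin, of "\<lambda>w. if in_type \<tau> (key w) then 2 - (key w - \<tau>) else 0"] *
      by (fastforce simp: typed_nbrs_def)
    ultimately show False using eq by simp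
  qed
  then obtain w where w: "w \<in> typed_nbrs G key v \<tau>" by blast
  have "w' = w" if w': "w' \<in> typed_nbrs G key v \<tau>" for w'
  proof -
    have "key w' = key w" using up[OF w] up[OF w'] dn[OF w] dn[OF w'] eq by linarith
    moreover have "w \<in> verts G" "w' \<in> verts G"
      using w w' nbrs_verts[OF G] by (auto simp: typed_nbrs_def)
    ultimately show "w' = w" using inj by (auto simp: is_keying_def dest: inj_onD)
  qed
  with w show "\<exists>w. typed_nbrs G key v \<tau> = {w}" by blast
next
  assume "\<exists>w. typed_nbrs G key v \<tau> = {w}"
  then obtain w where w: "typed_nbrs G key v \<tau> = {w}" by blast
  then have "in_type \<tau> (key w)" by (auto simp: typed_nbrs_def)
  then have "?D = 2 - (key w - \<tau>)" by (intro max0_typed_nbr[OF G w]) (simp add: in_type_def)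
  then show "offset G key v \<tau> + ?D = 2" using offset_singleton[OF G w] by simp
qed

text \<open>A term of value \<open>a\<close> is represented by \<open>(a + 1) * \<epsilon>\<close>,
  where \<open>\<rho> 0\<close> is \<epsilon> and \<open>\<rho> (Suc j)\<close> is the content of
  register \<open>j\<close>. Zero is thus \<epsilon> and a successor adds \<epsilon>, so arguments
  are compared without multiplication.\<close>

fun payload :: "(nat \<Rightarrow> real) \<Rightarrow> hterm \<Rightarrow> real" where
  "payload \<rho> HZero = \<rho> 0"
| "payload \<rho> (HVar j) = \<rho> (Suc j)"
| "payload \<rho> (HSuc j) = \<rho> (Suc j) + \<rho> 0"

lemma semilinear_payload:
  "(\<And>j. (\<lambda>e. R j e) \<in> semilinear V) \<Longrightarrow> (\<lambda>e. payload (\<lambda>j. R j e) t) \<in> semilinear V"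
  by (cases t) (auto intro: semilinear_add)

lemma semilinear_pred_in_type: "F \<in> semilinear V \<Longrightarrow> semilinear_pred V (\<lambda>e. in_type \<tau> (F e))"
  unfolding in_type_def
  by (intro semilinear_pred_conj semilinear_pred_less semilinear_add semilinear_of_nat semilinear_one)

lemma semilinear_of_bool: "semilinear_pred V P \<Longrightarrow> (\<lambda>e. of_bool (P e)) \<in> semilinear V"
  by (simp add: semilinear_pred_def)

lemmas semilinear_intros = semilinear_var semilinear_zero semilinear_one semilinear_add
  semilinear_minus semilinear_diff semilinear_of_nat semilinear_numeral semilinear_if
  semilinear_payload semilinear_of_bool semilinear_pred_const semilinear_pred_less
  semilinear_pred_eq semilinear_pred_not semilinear_pred_conj semilinear_pred_ball
  semilinear_pred_bex semilinear_pred_in_type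

text \<open>\<open>Par\<close> is the input times the key; \<open>Up\<close> and \<open>Dn\<close>
  hold the fractional part of a node and its difference from 2, for the uniqueness test;
  \<open>NUp\<close> and \<open>Uniq\<close> describe the neighbors of a type;
  \<open>Val \<tau> j\<close> is the entry of type \<open>j\<close> next to a node which itself has
  type \<open>\<tau>\<close>.\<close>

datatype name = Key | Par | Up nat | Dn nat | NUp nat | Uniq nat | Val nat nat | Err | RootOk | Out

fun emit :: "name \<Rightarrow> (name side \<Rightarrow> real) \<Rightarrow> real" where
  "emit (Up \<tau>) = (\<lambda>e. (if in_type \<tau> (e (Own Key)) then e (Own Key) - \<tau> else 0))"
| "emit (Dn \<tau>) = (\<lambda>e. (if in_type \<tau> (e (Own Key)) then 2 - (e (Own Key) - \<tau>) else 0))"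
| "emit Par = (\<lambda>e. e (Own Par))"
| "emit _ = (\<lambda>e. e (Own Key))"

text \<open>Guarding \<open>Val\<close> by the type of the node itself lets the next layer read,
  through a maximum over all neighbors, the registers of the unique neighbor of that type.\<close>

fun collect :: "name \<Rightarrow> (name side \<Rightarrow> real) \<Rightarrow> real" where
  "collect (NUp \<tau>) = (\<lambda>e. e (Agg (Up \<tau>)))"
| "collect (Uniq \<tau>) = (\<lambda>e. of_bool (e (Agg (Up \<tau>)) + e (Agg (Dn \<tau>)) = 2))"
| "collect (Val \<tau> j) = (\<lambda>e. (if in_type \<tau> (e (Own Key)) then e (Agg (Up j)) else 0))"
| "collect Par = (\<lambda>e. e (Own Par))"
| "collect _ = (\<lambda>e. e (Own Key))"

fun decide :: "name \<Rightarrow> (name side \<Rightarrow> real) \<Rightarrow> real" where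
  "decide _ = (\<lambda>e. of_bool (e (Own RootOk) = 1 \<and> \<not> 0 < e (Agg Err)))"

text \<open>Only the key and its multiple are read, so the fixed part of the network starts in
  dimension 2 and is independent of the labels.\<close>

lemma semilinear_emit: "emit c \<in> semilinear (Own ` {Key, Par} \<union> Agg ` {Key, Par})"
  by (cases c) (auto intro!: semilinear_intros)

lemma semilinear_collect: "collect c \<in> semilinear UNIV"
  by (cases c) (auto intro!: semilinear_intros)

lemma semilinear_decide: "decide c \<in> semilinear UNIV"
  by (auto intro!: semilinear_intros)

text \<open>The node types are: \<open>0\<close> for the hub, whose key is the unit \<open>\<epsilon>\<close>; \<open>j + 1\<close> for the values of the
  clause variable \<open>j < d\<close>, where the value \<open>a\<close> has the key \<open>j + 1 + (a + 1) \<epsilon>\<close>; and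
  \<open>cell_type i k\<close> for the instances of the clause \<open>i\<close>. Every instance comes in three copies
  \<open>k < 3\<close>, and its premises are taken from the copies \<open>k + 1\<close> modulo 3: this
  orients the undirected edges between conclusions and premises.\<close>

locale derivation_checker =
  fixes C :: "'p clause list" and d root :: nat
begin

definition cell_type :: "nat \<Rightarrow> nat \<Rightarrow> nat" where
  "cell_type i k = Suc d + 3 * i + k"

lemma cell_type_inject:
  "k < 3 \<Longrightarrow> k' < 3 \<Longrightarrow> cell_type i k = cell_type i' k' \<longleftrightarrow> i = i' \<and> k = k'"
  unfolding cell_type_def by presburger

text \<open>\<open>i'\<close> is a candidate for the clause proving \<open>b\<close>. The strict
  inequality between fractional parts excludes circular derivations, the equality at 0 makes both
  cells use the same hub, and arguments are compared in payload form.\<close>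

definition premise_ok :: "nat \<Rightarrow> nat \<Rightarrow> 'p atom \<Rightarrow> nat \<Rightarrow> (name side \<Rightarrow> real) \<Rightarrow> bool" where
  "premise_ok i k b i' e \<longleftrightarrow> fst (fst (C ! i')) = fst b \<and> length (snd (fst (C ! i'))) = length (snd b) \<and>
     e (Own (Uniq (cell_type i' (Suc k mod 3)))) = 1 \<and>
     e (Own (NUp (cell_type i' (Suc k mod 3)))) < e (Own Key) - of_nat (cell_type i k) \<and>
     e (Agg (Val (cell_type i' (Suc k mod 3)) 0)) = e (Own (NUp 0)) \<and>
     (\<forall>l\<in>{..<length (snd b)}.
        payload (\<lambda>j. e (Agg (Val (cell_type i' (Suc k mod 3)) j))) (snd (fst (C ! i')) ! l)
        = payload (\<lambda>j. e (Own (NUp j))) (snd b ! l))"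

definition cell_ok :: "nat \<Rightarrow> nat \<Rightarrow> (name side \<Rightarrow> real) \<Rightarrow> bool" where
  "cell_ok i k e \<longleftrightarrow> (\<forall>j\<in>{..d}. e (Own (Uniq j)) = 1) \<and>
     (\<forall>b\<in>set (snd (C ! i)). \<exists>i'\<in>{..<length C}. premise_ok i k b i' e)"

text \<open>At the hub, \<open>Par\<close> plus \<open>Key\<close> is \<open>x + 1\<close> times the
  unit, so \<open>RootOk\<close> says that the largest first register among adjacent root cells of
  copy 0 holds the value \<open>x\<close>.\<close>

fun verify :: "name \<Rightarrow> (name side \<Rightarrow> real) \<Rightarrow> real" where
  "verify Err = (\<lambda>e. of_bool (\<exists>i\<in>{..<length C}. \<exists>k\<in>{..<3}.
      in_type (cell_type i k) (e (Own Key)) \<and> \<not> cell_ok i k e))"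
| "verify RootOk = (\<lambda>e. of_bool (in_type 0 (e (Own Key)) \<and>
      e (Agg (Val (cell_type root 0) 1)) = e (Own Par) + e (Own Key)))"
| "verify _ = (\<lambda>e. 0)"

lemma semilinear_verify: "verify c \<in> semilinear UNIV"
  by (cases c; simp only: verify.simps cell_ok_def premise_ok_def)
    (intro semilinear_intros finite_lessThan finite_atMost finite_set UNIV_I)+

section \<open>The graph conditions tested by the network\<close>

definition premise_valid :: "'v graph \<Rightarrow> ('v \<Rightarrow> real) \<Rightarrow> 'v \<Rightarrow> nat \<Rightarrow> nat \<Rightarrow> 'p atom \<Rightarrow> nat \<Rightarrow> 'v \<Rightarrow> bool" where
  "premise_valid G key v i k b i' w \<longleftrightarrow>
     fst (fst (C ! i')) = fst b \<and> length (snd (fst (C ! i'))) = length (snd b) \<and>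
     typed_nbrs G key v (cell_type i' (Suc k mod 3)) = {w} \<and>
     key w - cell_type i' (Suc k mod 3) < key v - cell_type i k \<and>
     offset G key w 0 = offset G key v 0 \<and>
     (\<forall>l<length (snd b). payload (offset G key w) (snd (fst (C ! i')) ! l)
        = payload (offset G key v) (snd b ! l))"

definition cell_valid :: "'v graph \<Rightarrow> ('v \<Rightarrow> real) \<Rightarrow> 'v \<Rightarrow> nat \<Rightarrow> nat \<Rightarrow> bool" where
  "cell_valid G key v i k \<longleftrightarrow> (\<forall>j\<le>d. \<exists>w. typed_nbrs G key v j = {w}) \<and>
     (\<forall>b\<in>set (snd (C ! i)). \<exists>i'<length C. \<exists>w. premise_valid G key v i k b i' w)"

definition valid_at :: "nat \<Rightarrow> 'v graph \<Rightarrow> ('v \<Rightarrow> real) \<Rightarrow> 'v \<Rightarrow> bool" where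
  "valid_at x G key u \<longleftrightarrow> in_type 0 (key u) \<and>
     max0 (nbrs G u) (\<lambda>w. if in_type (cell_type root 0) (key w) then offset G key w 1 else 0)
       = (real x + 1) * key u \<and>
     (\<forall>w\<in>nbrs G u. \<forall>i<length C. \<forall>k<3. in_type (cell_type i k) (key w) \<longrightarrow> cell_valid G key w i k)"

definition init_state :: "nat \<Rightarrow> ('v \<Rightarrow> real) \<Rightarrow> 'v \<Rightarrow> name \<Rightarrow> real" where
  "init_state x key v c = (if c = Par then real x * key v else key v)"

lemma max0_pos_iff:
  assumes "finite N" shows "0 < max0 N (\<lambda>v. of_bool (P v)) \<longleftrightarrow> (\<exists>v\<in>N. P v)"
proof
  assume "0 < max0 N (\<lambda>v. of_bool (P v))"
  then show "\<exists>v\<in>N. P v"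
    using max0_attained[OF assms, of "\<lambda>v. of_bool (P v)"] by (auto split: if_splits)
next
  assume "\<exists>v\<in>N. P v"
  then show "0 < max0 N (\<lambda>v. of_bool (P v))"
    using max0_ge[OF assms, of _ "\<lambda>v. of_bool (P v)"] by fastforce
qed

lemma network_valid_at:
  assumes G: "is_graph n G" and key: "is_keying G key"
  shows "0 < fold (layer_step G) [emit, collect, verify, decide] (init_state x key) u Out
    \<longleftrightarrow> valid_at x G key u"
proof -
  define st2 where "st2 = layer_step G emit (init_state x key)"
  define st3 where "st3 = layer_step G collect st2"
  define st4 where "st4 = layer_step G verify st3"
  have st2: "st2 v Key = key v" "st2 v Par = real x * key v"
    "st2 v (Up \<tau>) = (if in_type \<tau> (key v) then key v - \<tau> else 0)"
    "st2 v (Dn \<tau>) = (if in_type \<tau> (key v) then 2 - (key v - \<tau>) else 0)" for v \<tau>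
    by (simp_all add: st2_def layer_step_def init_state_def)
  have st3: "st3 v Key = key v" "st3 v Par = real x * key v" "st3 v (NUp \<tau>) = offset G key v \<tau>"
    "st3 v (Uniq \<tau>) = 1 \<longleftrightarrow> (\<exists>w. typed_nbrs G key v \<tau> = {w})"
    "st3 v (Val \<tau> j) = (if in_type \<tau> (key v) then offset G key v j else 0)" for v \<tau> j
    using unique_typed_nbr_iff[OF G key, of v \<tau>]
    by (simp_all add: st3_def layer_step_def st2 offset_def)
  let ?e = "\<lambda>v. case_side (st3 v) (\<lambda>c. max0 (nbrs G v) (\<lambda>w. st3 w c))"
  have agg: "max0 (nbrs G v) (\<lambda>w. st3 w (Val \<tau> j)) = offset G key w j"
    if w: "typed_nbrs G key v \<tau> = {w}" for v \<tau> w j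
    unfolding st3(5) by (rule max0_typed_nbr[OF G w offset_nonneg[OF G]])
  have "premise_ok i k b i' (?e v) \<longleftrightarrow> (\<exists>w. premise_valid G key v i k b i' w)" for i k b i' v
  proof
    assume ok: "premise_ok i k b i' (?e v)"
    then obtain w where "typed_nbrs G key v (cell_type i' (Suc k mod 3)) = {w}"
      by (auto simp: premise_ok_def st3)
    with ok show "\<exists>w. premise_valid G key v i k b i' w"
      by (auto simp: premise_ok_def premise_valid_def st3(1-4) agg offset_singleton[OF G] intro!: exI[of _ w])
  next
    assume "\<exists>w. premise_valid G key v i k b i' w"
    then show "premise_ok i k b i' (?e v)"
      by (auto simp: premise_ok_def premise_valid_def st3(1-4) agg offset_singleton[OF G])
  qed
  then have cell: "cell_ok i k (?e v) \<longleftrightarrow> cell_valid G key v i k" for i k v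
    by (simp add: cell_ok_def cell_valid_def st3(4) Ball_def Bex_def)
  have err: "st4 v Err = of_bool (\<exists>i\<in>{..<length C}. \<exists>k\<in>{..<3}.
      in_type (cell_type i k) (key v) \<and> \<not> cell_valid G key v i k)" for v
    by (simp add: st4_def layer_step_def cell st3(1))
  have root: "st4 v RootOk = of_bool (in_type 0 (key v) \<and>
      max0 (nbrs G v) (\<lambda>w. if in_type (cell_type root 0) (key w) then offset G key w 1 else 0)
       = (real x + 1) * key v)" for v
    by (simp add: st4_def layer_step_def st3(1,2,5) distrib_right del: One_nat_def)
  have "fold (layer_step G) [emit, collect, verify, decide] (init_state x key) u Out
    = layer_step G decide st4 u Out"
    by (simp add: st2_def st3_def st4_def)
  also have "\<dots> = of_bool (st4 u RootOk = 1 \<and> \<not> 0 < max0 (nbrs G u) (\<lambda>v. st4 v Err))"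
    by (simp add: layer_step_def)
  also have "\<dots> = of_bool (valid_at x G key u)"
    by (auto simp: err root max0_pos_iff finite_nbrs[OF G] valid_at_def)
  finally show ?thesis by simp
qed

subsection \<open>Accepted graphs contain derivations\<close>

lemma payload_eq_hval:
  assumes "\<rho> 0 = \<epsilon>" "\<And>j. Suc j \<le> d \<Longrightarrow> \<rho> (Suc j) = (a j + 1) * \<epsilon>" "\<And>j. t = HVar j \<or> t = HSuc j \<Longrightarrow> j < d"
  shows "payload \<rho> t = (hval a t + 1) * \<epsilon>"
  using assms by (cases t) (auto simp: algebra_simps)

definition vars_bounded :: bool where
  "vars_bounded \<longleftrightarrow> (\<forall>(h, bs)\<in>set C. \<forall>(q, ts)\<in>set (h # bs). \<forall>t\<in>set ts.
     \<forall>j. t = HVar j \<or> t = HSuc j \<longrightarrow> j < d)"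

text \<open>Induction on the number of nodes with a key of smaller fractional part, which decreases
  strictly from a cell to its premises. Register contents divided by the key of the hub, minus 1,
  give the valuation of the clause, and positivity of the contents gives the bound on
  variables.\<close>

lemma derivable_of_valid_cell:
  assumes G: "is_graph n G" and key: "is_keying G key" and u: "u \<in> verts G"
    and valid: "valid_at x G key u" and vars: vars_bounded
    and "v \<in> nbrs G u" "i < length C" "k < 3" "in_type (cell_type i k) (key v)"
  shows "offset G key v 0 = key u \<and> (\<forall>j\<le>d. 0 < offset G key v j) \<and>
    derivable (set C) (inst (\<lambda>j. if j < d then offset G key v (Suc j) / key u - 1 else 0) (fst (C ! i)))"
  using assms(6-)
proof (induction "card {w \<in> verts G. frac (key w) < frac (key v)}" arbitrary: v i k rule: less_induct)
  case less
  let ?a = "\<lambda>v j. if j < d then offset G key v (Suc j) / key u - 1 else 0"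
  have u0: "0 < key u" "key u < 1" "in_type 0 (key u)"
    using valid by (auto simp: valid_at_def in_type_def)
  have v: "cell_valid G key v i k" using valid less.prems by (auto simp: valid_at_def)
  note uniq = conjunct1[OF v[unfolded cell_valid_def], rule_format]
    and prems = conjunct2[OF v[unfolded cell_valid_def], rule_format]
  have sym: "u \<in> nbrs G w" if "w \<in> nbrs G u" for w
    using that G by (auto simp: nbrs_def is_graph_def sym_def)
  have off: "0 < offset G key v j" if j: "j \<le> d" for j
  proof -
    obtain w where w: "typed_nbrs G key v j = {w}" using uniq[OF j] by blast
    then have "in_type j (key w)" by (auto simp: typed_nbrs_def)
    then show ?thesis using offset_singleton[OF G w] by (simp add: in_type_def)
  qed
  have off0: "offset G key v 0 = key u"
  proof -
    obtain w where w: "typed_nbrs G key v 0 = {w}" using uniq[of 0] by blast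
    moreover have "u \<in> typed_nbrs G key v 0" using sym less.prems(1) u0(3) by (simp add: typed_nbrs_def)
    ultimately have "w = u" by simp
    then show ?thesis using offset_singleton[OF G w] by simp
  qed
  have frac_eq: "frac z = z - real \<tau>" if "in_type \<tau> z" for \<tau> z
    using that unfolding in_type_def frac_def
    by (metis add.commute floor_unique less_eq_real_def of_int_of_nat_eq)
  obtain h bs where Ci: "C ! i = (h, bs)" by (metis surj_pair)
  have C: "(h, bs) \<in> set C" using less.prems(2) Ci nth_mem by fastforce
  have bound: "j < d" if "b \<in> set (h # bs)" "t \<in> set (snd b)" "t = HVar j \<or> t = HSuc j" for b t j
    using vars C that unfolding vars_bounded_def by fastforce
  have body: "derivable (set C) (inst (?a v) b)" if b: "b \<in> set bs" for b
  proof -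
    obtain i' w where i': "i' < length C" and w: "premise_valid G key v i k b i' w"
      using prems[of b] b Ci by auto
    let ?\<tau> = "cell_type i' (Suc k mod 3)"
    have wv: "w \<in> nbrs G v" "in_type ?\<tau> (key w)" and hd: "fst (fst (C ! i')) = fst b"
      and len: "length (snd (fst (C ! i'))) = length (snd b)"
      using w by (auto simp: premise_valid_def typed_nbrs_def)
    \<comment> \<open>The premise \<open>w\<close> has a neighbor of type 0 with the same key as
      \<open>u\<close>; keys are injective, so this is \<open>u\<close> itself. Hence
      \<open>w\<close> is adjacent to \<open>u\<close> and has been checked as well.\<close>
    have "offset G key w 0 = key u" using w off0 by (simp add: premise_valid_def)
    with u0 offset_attained[OF G, of key w 0] obtain u' where
      u': "u' \<in> typed_nbrs G key w 0" "key u' = key u" by auto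
    then have "u' = u"
      using key u nbrs_verts[OF G] by (auto simp: is_keying_def typed_nbrs_def dest: inj_onD)
    with u' have wu: "w \<in> nbrs G u"
      using G by (auto simp: typed_nbrs_def nbrs_def is_graph_def sym_def)
    have "frac (key w) < frac (key v)"
      using w frac_eq[OF wv(2)] frac_eq[OF less.prems(4)] by (simp add: premise_valid_def)
    then have "{w' \<in> verts G. frac (key w') < frac (key w)} \<subset> {w' \<in> verts G. frac (key w') < frac (key v)}"
      using nbrs_verts[OF G wu] by auto
    then have "card {w' \<in> verts G. frac (key w') < frac (key w)} < card {w' \<in> verts G. frac (key w') < frac (key v)}"
      using G by (intro psubset_card_mono) (auto simp: is_graph_def)
    from less.hyps[OF this wu i' _ wv(2)]
    have w0: "offset G key w 0 = key u" and D: "derivable (set C) (inst (?a w) (fst (C ! i')))"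
      by auto
    obtain h' bs' where Ci': "C ! i' = (h', bs')" by (metis surj_pair)
    have C': "(h', bs') \<in> set C" using i' Ci' nth_mem by fastforce
    have bound': "j < d" if "t \<in> set (snd h')" "t = HVar j \<or> t = HSuc j" for t j
      using vars C' that unfolding vars_bounded_def by fastforce
    have "hval (?a w) (snd h' ! l) = hval (?a v) (snd b ! l)" if l: "l < length (snd b)" for l
    proof -
      have "payload (offset G key w) (snd h' ! l) = (hval (?a w) (snd h' ! l) + 1) * key u"
        using u0 w0 l len bound'[OF nth_mem, of l] by (intro payload_eq_hval) (auto simp: Ci')
      moreover have "payload (offset G key v) (snd b ! l) = (hval (?a v) (snd b ! l) + 1) * key u"
        using u0 off0 l b bound[OF _ nth_mem, of b l] by (intro payload_eq_hval) auto
      ultimately show ?thesis using w l u0 by (auto simp: premise_valid_def Ci')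
    qed
    then have "inst (?a w) (fst (C ! i')) = inst (?a v) b"
      using hd len by (auto simp: inst_def Ci' intro: nth_equalityI)
    then show ?thesis using D by simp
  qed
  have pos: "0 < ?a v j + 1" for j
    using off[of "Suc j"] u0 by simp
  have "derivable (set C) (inst (?a v) h)" by (rule derivableI[OF C pos body])
  then show ?case using off off0 Ci by auto
qed

lemma derivable_of_valid_at:
  assumes G: "is_graph n G" and key: "is_keying G key" and u: "u \<in> verts G"
    and valid: "valid_at x G key u" and vars: vars_bounded
    and root: "root < length C" "fst (C ! root) = (q, [HVar 0])"
  shows "derivable (set C) (q, [real x])"
proof -
  have u0: "0 < key u" using valid by (auto simp: valid_at_def in_type_def)
  let ?f = "\<lambda>w. if in_type (cell_type root 0) (key w) then offset G key w 1 else 0"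
  have max: "max0 (nbrs G u) ?f = (real x + 1) * key u" using valid by (simp add: valid_at_def)
  \<comment> \<open>A nonzero maximum is attained by a neighbor, and a nonzero value there means
    that this neighbor is a root cell.\<close>
  with u0 have "max0 (nbrs G u) ?f \<noteq> 0" by (simp add: add_nonneg_eq_0_iff)
  from max0_attained[OF finite_nbrs[OF G] this] max
  obtain w where w: "w \<in> nbrs G u" "?f w = (real x + 1) * key u" by auto
  with u0 have t: "in_type (cell_type root 0) (key w)" "offset G key w 1 = (real x + 1) * key u"
    by (auto simp: add_nonneg_eq_0_iff split: if_splits)
  have "(fst (C ! root), snd (C ! root)) \<in> set C" using root(1) by simp
  then have "0 < d" using vars root(2) unfolding vars_bounded_def by fastforce
  with derivable_of_valid_cell[OF G key u valid vars w(1) root(1) _ t(1)] root(2) t(2) u0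
  show ?thesis by simp
qed

subsection \<open>Derivations yield accepted graphs\<close>

text \<open>Derivations in linear form. The position of an entry later determines the fractional
  part of its key, so that premises come out smaller.\<close>

definition justified :: "(nat \<times> (nat \<Rightarrow> nat)) list \<Rightarrow> bool" where
  "justified L \<longleftrightarrow> (\<forall>s<length L. fst (L ! s) < length C \<and>
     (\<forall>b\<in>set (snd (C ! fst (L ! s))). \<exists>s'<s.
        inst (snd (L ! s')) (fst (C ! fst (L ! s'))) = inst (snd (L ! s)) b))"

lemma justified_append:
  assumes "justified L" "justified L'" shows "justified (L @ L')"
  unfolding justified_def
proof (intro allI impI)
  fix s assume s: "s < length (L @ L')"
  show "fst ((L @ L') ! s) < length C \<and> (\<forall>b\<in>set (snd (C ! fst ((L @ L') ! s))). \<exists>s'<s.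
      inst (snd ((L @ L') ! s')) (fst (C ! fst ((L @ L') ! s'))) = inst (snd ((L @ L') ! s)) b)"
  proof (cases "s < length L")
    case True
    with assms(1) show ?thesis unfolding justified_def by (fastforce simp: nth_append)
  next
    case False
    define t where "t = s - length L"
    have t: "t < length L'" "s = length L + t" using s False by (auto simp: t_def)
    show ?thesis
    proof (intro conjI ballI)
      show "fst ((L @ L') ! s) < length C" using assms(2) t by (simp add: justified_def)
      fix b assume "b \<in> set (snd (C ! fst ((L @ L') ! s)))"
      then obtain t' where "t' < t"
        "inst (snd (L' ! t')) (fst (C ! fst (L' ! t'))) = inst (snd (L' ! t)) b"
        using assms(2) t by (auto simp: justified_def)
      then show "\<exists>s'<s. inst (snd ((L @ L') ! s')) (fst (C ! fst ((L @ L') ! s')))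
          = inst (snd ((L @ L') ! s)) b"
        using t by (intro exI[of _ "length L + t'"]) simp
    qed
  qed
qed

lemma justified_snoc:
  assumes L: "justified L" and i: "i < length C"
    and b: "\<And>b. b \<in> set (snd (C ! i)) \<Longrightarrow> \<exists>(i', a')\<in>set L. inst a' (fst (C ! i')) = inst a b"
  shows "justified (L @ [(i, a)])"
proof -
  have "\<exists>s'<length L. inst (snd (L ! s')) (fst (C ! fst (L ! s'))) = inst a b"
    if "b \<in> set (snd (C ! i))" for b
    using b[OF that] by (fastforce simp: in_set_conv_nth)
  with L i show ?thesis
    unfolding justified_def by (fastforce simp: less_Suc_eq nth_append)
qed

lemma derivable_imp_justified:
  assumes "derivable (set C) x"
  shows "\<exists>L. justified L \<and> (\<exists>(i, a)\<in>set L. inst a (fst (C ! i)) = x)"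
  using assms
proof (induction rule: derivable.induct)
  case (derivableI h bs a)
  obtain i where i: "i < length C" "C ! i = (h, bs)"
    using derivableI(1) by (auto simp: in_set_conv_nth)
  have "\<exists>L. justified L \<and> (\<forall>b\<in>set bs'. \<exists>(i, a')\<in>set L. inst a' (fst (C ! i)) = inst a b)"
    if "set bs' \<subseteq> set bs" for bs'
    using that
  proof (induction bs')
    case Nil
    have "justified []" by (simp add: justified_def)
    then show ?case by auto
  next
    case (Cons b bs')
    then obtain L L' where L: "justified L" "\<exists>(i, a')\<in>set L. inst a' (fst (C ! i)) = inst a b"
      and L': "justified L'" "\<forall>b\<in>set bs'. \<exists>(i, a')\<in>set L'. inst a' (fst (C ! i)) = inst a b"
      using derivableI(4) by (metis insert_subset list.set(2))
    show ?case
      using justified_append[OF L(1) L'(1)] L(2) L'(2) by (intro exI[of _ "L @ L'"]) fastforce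
  qed
  then obtain L where L: "justified L"
    "\<And>b. b \<in> set bs \<Longrightarrow> \<exists>(i, a')\<in>set L. inst a' (fst (C ! i)) = inst a b" by blast
  have "justified (L @ [(i, a)])"
    by (rule justified_snoc[OF L(1) i(1)]) (use i(2) L(2) in auto)
  then show ?case using i(2) by (intro exI[of _ "L @ [(i, a)]"]) auto
qed

text \<open>For a justified \<open>L\<close> some position below \<open>s\<close> has the right
  conclusion, so the least such position also lies below \<open>s\<close>.\<close>

definition premise_of :: "(nat \<times> (nat \<Rightarrow> nat)) list \<Rightarrow> nat \<Rightarrow> 'p atom \<Rightarrow> nat" where
  "premise_of L s b = (LEAST s'. inst (snd (L ! s')) (fst (C ! fst (L ! s'))) = inst (snd (L ! s)) b)"

lemma premise_of:
  assumes "justified L" "s < length L" "b \<in> set (snd (C ! fst (L ! s)))"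
  shows "premise_of L s b < s"
    "inst (snd (L ! premise_of L s b)) (fst (C ! fst (L ! premise_of L s b))) = inst (snd (L ! s)) b"
proof -
  obtain s' where s': "s' < s" "inst (snd (L ! s')) (fst (C ! fst (L ! s'))) = inst (snd (L ! s)) b"
    using assms unfolding justified_def by blast
  from s'(2) show "inst (snd (L ! premise_of L s b)) (fst (C ! fst (L ! premise_of L s b)))
      = inst (snd (L ! s)) b"
    unfolding premise_of_def by (rule LeastI)
  show "premise_of L s b < s"
    using s'(1) Least_le[of "\<lambda>s'. inst (snd (L ! s')) (fst (C ! fst (L ! s'))) = inst (snd (L ! s)) b", OF s'(2)]
    unfolding premise_of_def by linarith
qed

text \<open>A node is a pair of a node type and an index, which is the position in \<open>L\<close> for cells and the
  value for registers.\<close>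

inductive arc :: "(nat \<times> (nat \<Rightarrow> nat)) list \<Rightarrow> nat \<times> nat \<Rightarrow> nat \<times> nat \<Rightarrow> bool" for L where
  arc_hub: "s < length L \<Longrightarrow> k < 3 \<Longrightarrow> arc L (0, 0) (cell_type (fst (L ! s)) k, s)"
| arc_reg: "s < length L \<Longrightarrow> k < 3 \<Longrightarrow> j < d \<Longrightarrow>
    arc L (cell_type (fst (L ! s)) k, s) (Suc j, snd (L ! s) j)"
| arc_premise: "s < length L \<Longrightarrow> k < 3 \<Longrightarrow> b \<in> set (snd (C ! fst (L ! s))) \<Longrightarrow> s' = premise_of L s b \<Longrightarrow>
    arc L (cell_type (fst (L ! s)) k, s) (cell_type (fst (L ! s')) (Suc k mod 3), s')"

text \<open>The vertices fill a rectangle of types and indices below \<open>B\<close>; those on no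
  arc stay isolated and do not affect the checks made from the hub.\<close>

definition graph_of :: "nat \<Rightarrow> nat \<Rightarrow> (nat \<times> (nat \<Rightarrow> nat)) list \<Rightarrow> nat graph" where
  "graph_of n B L = \<lparr>verts = prod_encode ` ({..<cell_type (length C) 0} \<times> {..<B}),
     edges = {(prod_encode p, prod_encode q) | p q. arc L p q \<or> arc L q p},
     lab = (\<lambda>_. replicate n False)\<rparr>"

text \<open>With \<epsilon> = \<open>1 / (real B + 1)\<close>, the hub \<open>(0, 0)\<close> gets
  the key \<epsilon>, a register of value \<open>s\<close> the fractional part
  \<open>(s + 1) * \<epsilon>\<close>, and a cell a larger fractional part than its premises.
  Indices below \<open>B\<close> keep all of these below 1.\<close>

definition key_of :: "nat \<Rightarrow> nat \<Rightarrow> real" where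
  "key_of B v = (case prod_decode v of (\<tau>, s) \<Rightarrow> real \<tau> + (real s + 1) / (real B + 1))"

lemma key_of_encode: "key_of B (prod_encode (\<tau>, s)) = real \<tau> + (real s + 1) / (real B + 1)"
  by (simp add: key_of_def)

lemma in_type_key_of: "s < B \<Longrightarrow> in_type \<tau>' (key_of B (prod_encode (\<tau>, s))) \<longleftrightarrow> \<tau>' = \<tau>"
proof -
  assume "s < B"
  then have "in_type \<tau> (key_of B (prod_encode (\<tau>, s)))"
    by (simp add: key_of_encode in_type_def field_simps)
  then show ?thesis using in_type_unique by blast
qed

lemma is_keying_graph_of: "is_keying (graph_of n B L) (key_of B)"
  unfolding is_keying_def
proof (rule inj_onI)
  fix v w assume "v \<in> verts (graph_of n B L)" "w \<in> verts (graph_of n B L)" and eq: "key_of B v = key_of B w"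
  then obtain \<tau> s \<tau>' s' where v: "v = prod_encode (\<tau>, s)" "s < B" and w: "w = prod_encode (\<tau>', s')" "s' < B"
    by (auto simp: graph_of_def)
  have "\<tau> = \<tau>'" using in_type_key_of[OF v(2), of \<tau> \<tau>] in_type_key_of[OF w(2), of \<tau> \<tau>'] eq v w by simp
  then show "v = w" using eq v w by (simp add: key_of_encode field_simps)
qed

section \<open>Properties of the keyed graph of a derivation\<close>

context
  fixes n B :: nat and L
  assumes L: "justified L" and len: "length L < B"
    and B: "\<And>s j. s < length L \<Longrightarrow> j < d \<Longrightarrow> snd (L ! s) j < B"
    and distinct: "\<And>h bs. (h, bs) \<in> set C \<Longrightarrow> distinct (map fst bs)"
    and vars: vars_bounded
begin

abbreviation "DG \<equiv> graph_of n B L"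
abbreviation "DK \<equiv> key_of B"
abbreviation "eps \<equiv> 1 / (real B + 1)"
abbreviation "cell s k \<equiv> prod_encode (cell_type (fst (L ! s)) k, s)"

lemma clause_index: "s < length L \<Longrightarrow> fst (L ! s) < length C"
  using L by (simp add: justified_def)

lemma arc_bounds:
  assumes "arc L p q"
  shows "fst p < cell_type (length C) 0 \<and> snd p < B \<and> fst q < cell_type (length C) 0 \<and> snd q < B \<and> p \<noteq> q"
  using assms
proof cases
  case (arc_hub s k)
  then show ?thesis using clause_index[of s] len by (auto simp: cell_type_def)
next
  case (arc_reg s k j)
  then show ?thesis using clause_index[of s] len B[of s j] by (auto simp: cell_type_def)
next
  case (arc_premise s k b s')
  have "s' < s" using premise_of(1)[OF L] arc_premise by simp
  moreover have "Suc k mod 3 < 3" by simp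
  ultimately show ?thesis
    using arc_premise clause_index[of s] clause_index[of s'] len
    by (auto simp: cell_type_def)
qed

lemma is_graph_graph_of: "is_graph n DG"
  unfolding is_graph_def
proof (intro conjI)
  show "edges DG \<subseteq> verts DG \<times> verts DG"
    using arc_bounds by (fastforce simp: graph_of_def image_iff mem_Times_iff)
  show "irrefl (edges DG)"
    using arc_bounds by (auto simp: graph_of_def irrefl_def prod_encode_eq)
  show "sym (edges DG)" by (auto simp: graph_of_def sym_def)
qed (auto simp: graph_of_def)

lemma mem_nbrs: "prod_encode q \<in> nbrs DG (prod_encode p) \<longleftrightarrow> arc L p q \<or> arc L q p"
proof -
  have "(prod_encode p, prod_encode q) \<in> edges DG \<longleftrightarrow>
      (\<exists>p' q'. p = p' \<and> q = q' \<and> (arc L p' q' \<or> arc L q' p'))"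
    by (simp add: graph_of_def prod_encode_eq del: split_paired_Ex)
  then show ?thesis by (simp add: nbrs_def)
qed

lemma mem_typed_nbrs:
  "w \<in> typed_nbrs DG DK (prod_encode p) \<tau> \<longleftrightarrow>
    (\<exists>s. w = prod_encode (\<tau>, s) \<and> (arc L p (\<tau>, s) \<or> arc L (\<tau>, s) p))"
proof -
  obtain \<tau>' s where w: "w = prod_encode (\<tau>', s)" by (metis prod.collapse prod_decode_inverse)
  show ?thesis
  proof (cases "arc L p (\<tau>', s) \<or> arc L (\<tau>', s) p")
    case True
    then have "s < B" using arc_bounds by fastforce
    with True show ?thesis
      unfolding typed_nbrs_def w by (auto simp: mem_nbrs in_type_key_of prod_encode_eq)
  qed (auto simp: typed_nbrs_def w mem_nbrs prod_encode_eq)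
qed

lemma cell_type_neq [simp]:
  "cell_type i k \<noteq> 0" "0 \<noteq> cell_type i k"
  "j < d \<Longrightarrow> cell_type i k \<noteq> Suc j" "j < d \<Longrightarrow> Suc j \<noteq> cell_type i k"
  by (auto simp: cell_type_def)

lemma hub_typed_nbr:
  assumes "s < length L" "k < 3"
  shows "typed_nbrs DG DK (cell s k) 0 = {prod_encode (0, 0)}"
  using assms by (auto simp: mem_typed_nbrs arc.simps prod_encode_eq cell_type_inject)

lemma reg_typed_nbr:
  assumes "s < length L" "k < 3" "j < d"
  shows "typed_nbrs DG DK (cell s k) (Suc j) = {prod_encode (Suc j, snd (L ! s) j)}"
  using assms by (auto simp: mem_typed_nbrs arc.simps prod_encode_eq cell_type_inject)

text \<open>Two premises of one type belong to the same clause, hence have the same predicate, and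
  the predicates in a body are distinct. Edges in the other direction are excluded by the copies: a
  cell of copy \<open>k + 1\<close> has its premises in copy \<open>k + 2\<close>, not
  \<open>k\<close>, modulo 3.\<close>

lemma premise_typed_nbr:
  assumes s: "s < length L" and k: "k < 3" and b: "b \<in> set (snd (C ! fst (L ! s)))"
  defines "s' \<equiv> premise_of L s b"
  shows "typed_nbrs DG DK (cell s k) (cell_type (fst (L ! s')) (Suc k mod 3)) = {cell s' (Suc k mod 3)}"
proof -
  have hd: "fst (fst (C ! fst (L ! premise_of L s c))) = fst c" if "c \<in> set (snd (C ! fst (L ! s)))" for c
    using arg_cong[OF premise_of(2)[OF L s that], of fst] by (simp add: inst_def)
  have "distinct (map fst (snd (C ! fst (L ! s))))"
    using distinct[of "fst (C ! fst (L ! s))" "snd (C ! fst (L ! s))"] clause_index[OF s] by simp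
  then have inj: "c = b" if "c \<in> set (snd (C ! fst (L ! s)))" "fst c = fst b" for c
    using that b by (auto simp: distinct_map dest: inj_onD)
  have k': "Suc k mod 3 < 3" "Suc k mod 3 \<noteq> k" "Suc (Suc k mod 3) mod 3 \<noteq> k" using k by presburger+
  have "arc L (cell_type (fst (L ! s)) k, s) (cell_type (fst (L ! s')) (Suc k mod 3), t)
      \<or> arc L (cell_type (fst (L ! s')) (Suc k mod 3), t) (cell_type (fst (L ! s)) k, s) \<longleftrightarrow> t = s'" for t
  proof
    assume "arc L (cell_type (fst (L ! s)) k, s) (cell_type (fst (L ! s')) (Suc k mod 3), t)
      \<or> arc L (cell_type (fst (L ! s')) (Suc k mod 3), t) (cell_type (fst (L ! s)) k, s)"
    then show "t = s'"
    proof
      assume "arc L (cell_type (fst (L ! s)) k, s) (cell_type (fst (L ! s')) (Suc k mod 3), t)"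
      then show "t = s'"
      proof cases
        case (arc_premise k2 c)
        have "fst (L ! s') = fst (L ! t)" using arc_premise k k' by (simp add: cell_type_inject)
        then have "fst c = fst b" using hd[OF b] hd[of c] arc_premise by (simp add: s'_def)
        with inj[of c] arc_premise have "c = b" by simp
        then show ?thesis using arc_premise by (simp add: s'_def)
      qed (use k k' in auto)
    next
      assume "arc L (cell_type (fst (L ! s')) (Suc k mod 3), t) (cell_type (fst (L ! s)) k, s)"
      then show "t = s'"
      proof cases
        case (arc_premise k2 c)
        then show ?thesis using k k' by (auto simp: cell_type_inject)
      qed (use k k' in auto)
    qed
  next
    assume "t = s'"
    then show "arc L (cell_type (fst (L ! s)) k, s) (cell_type (fst (L ! s')) (Suc k mod 3), t)
      \<or> arc L (cell_type (fst (L ! s')) (Suc k mod 3), t) (cell_type (fst (L ! s)) k, s)"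
      using arc_premise[OF s k b] by (simp add: s'_def)
  qed
  then show ?thesis by (auto simp: mem_typed_nbrs)
qed

lemma offset_cell:
  assumes "s < length L" "k < 3"
  shows "offset DG DK (cell s k) 0 = eps"
    "j < d \<Longrightarrow> offset DG DK (cell s k) (Suc j) = (real (snd (L ! s) j) + 1) * eps"
  using offset_singleton[OF is_graph_graph_of hub_typed_nbr[OF assms]]
    offset_singleton[OF is_graph_graph_of reg_typed_nbr[OF assms]]
  by (simp_all add: key_of_encode)

lemma payload_cell:
  assumes s: "s < length L" and k: "k < 3"
    and t: "b \<in> set (fst (C ! fst (L ! s)) # snd (C ! fst (L ! s)))" "t \<in> set (snd b)"
  shows "payload (offset DG DK (cell s k)) t = (real (hval (snd (L ! s)) t) + 1) * eps"
proof -
  have "(fst (C ! fst (L ! s)), snd (C ! fst (L ! s))) \<in> set C" using clause_index[OF s] by simp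
  then have "j < d" if "t = HVar j \<or> t = HSuc j" for j
    using vars t that unfolding vars_bounded_def by fastforce
  then have "payload (offset DG DK (cell s k)) t = (hval (\<lambda>j. real (snd (L ! s) j)) t + 1) * eps"
    using offset_cell[OF s k] by (intro payload_eq_hval) auto
  also have "hval (\<lambda>j. real (snd (L ! s) j)) t = real (hval (snd (L ! s)) t)"
    by (cases t) auto
  finally show ?thesis .
qed

lemma cell_valid_cell:
  assumes s: "s < length L" and k: "k < 3"
  shows "cell_valid DG DK (cell s k) (fst (L ! s)) k"
  unfolding cell_valid_def
proof (intro conjI allI impI ballI)
  fix j assume "j \<le> d"
  then show "\<exists>w. typed_nbrs DG DK (cell s k) j = {w}"
    using hub_typed_nbr[OF s k] reg_typed_nbr[OF s k] by (cases j) auto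
next
  fix b assume b: "b \<in> set (snd (C ! fst (L ! s)))"
  define s' where "s' = premise_of L s b"
  have s': "s' < s" "inst (snd (L ! s')) (fst (C ! fst (L ! s'))) = inst (snd (L ! s)) b"
    using premise_of[OF L s b] by (auto simp: s'_def)
  have s'L: "s' < length L" and k': "Suc k mod 3 < 3" using s s' by auto
  have hd: "fst (fst (C ! fst (L ! s'))) = fst b"
    and args: "map (hval (snd (L ! s'))) (snd (fst (C ! fst (L ! s')))) = map (hval (snd (L ! s))) (snd b)"
    using s'(2) by (auto simp: inst_def)
  have len': "length (snd (fst (C ! fst (L ! s')))) = length (snd b)"
    using arg_cong[OF args, of length] by simp
  have "payload (offset DG DK (cell s' (Suc k mod 3))) (snd (fst (C ! fst (L ! s'))) ! l)
      = payload (offset DG DK (cell s k)) (snd b ! l)" if l: "l < length (snd b)" for l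
  proof -
    have "hval (snd (L ! s')) (snd (fst (C ! fst (L ! s'))) ! l) = hval (snd (L ! s)) (snd b ! l)"
      using arg_cong[OF args, of "\<lambda>xs. xs ! l"] l len' by simp
    then show ?thesis
      using payload_cell[OF s'L k', of "fst (C ! fst (L ! s'))"] payload_cell[OF s k, of b] b l len'
      by simp
  qed
  then have "premise_valid DG DK (cell s k) (fst (L ! s)) k b (fst (L ! s')) (cell s' (Suc k mod 3))"
    using hd len' premise_typed_nbr[OF s k b] s'(1) offset_cell(1)[OF s k] offset_cell(1)[OF s'L k']
    by (simp add: premise_valid_def s'_def key_of_encode divide_strict_right_mono)
  then show "\<exists>i'<length C. \<exists>w. premise_valid DG DK (cell s k) (fst (L ! s)) k b i' w"
    using clause_index[OF s'L] by blast
qed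

lemma typed_nbrs_hub:
  assumes "k < 3"
  shows "w \<in> typed_nbrs DG DK (prod_encode (0, 0)) (cell_type i k) \<longleftrightarrow>
    (\<exists>s<length L. fst (L ! s) = i \<and> w = cell s k)"
proof -
  have "arc L (0, 0) (cell_type i k, s) \<or> arc L (cell_type i k, s) (0, 0) \<longleftrightarrow>
      s < length L \<and> fst (L ! s) = i" for s
  proof
    assume "arc L (0, 0) (cell_type i k, s) \<or> arc L (cell_type i k, s) (0, 0)"
    then show "s < length L \<and> fst (L ! s) = i"
      using assms by (elim disjE arc.cases) (auto simp: cell_type_inject)
  next
    assume "s < length L \<and> fst (L ! s) = i"
    then show "arc L (0, 0) (cell_type i k, s) \<or> arc L (cell_type i k, s) (0, 0)"
      using arc_hub[of s L k] assms by auto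
  qed
  then show ?thesis unfolding mem_typed_nbrs by auto
qed

text \<open>Since the root clause occurs only once in \<open>L\<close>, the maximum at the hub reads
  the register of a single cell.\<close>

lemma valid_at_graph_of:
  assumes r: "r < length L" "fst (L ! r) = root" "\<And>s. s < length L \<Longrightarrow> fst (L ! s) = root \<Longrightarrow> s = r"
    and d: "0 < d"
  shows "valid_at (snd (L ! r) 0) DG DK (prod_encode (0, 0))"
  unfolding valid_at_def
proof (intro conjI ballI allI impI)
  show "in_type 0 (DK (prod_encode (0, 0)))" using len by (simp add: in_type_key_of)
  have "typed_nbrs DG DK (prod_encode (0, 0)) (cell_type root 0) = {cell r 0}"
    using r(1,2) by (auto simp: typed_nbrs_hub dest: r(3))
  from max0_typed_nbr[OF is_graph_graph_of this offset_nonneg[OF is_graph_graph_of]]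
  show "max0 (nbrs DG (prod_encode (0, 0)))
      (\<lambda>w. if in_type (cell_type root 0) (DK w) then offset DG DK w 1 else 0)
      = (real (snd (L ! r) 0) + 1) * DK (prod_encode (0, 0))"
    using offset_cell(2)[OF r(1), of 0 0] d by (simp add: key_of_encode)
next
  fix w i k assume w: "w \<in> nbrs DG (prod_encode (0, 0))" and ik: "i < length C" "k < 3"
    and t: "in_type (cell_type i k) (DK w)"
  have "w \<in> typed_nbrs DG DK (prod_encode (0, 0)) (cell_type i k)"
    using w t by (simp add: typed_nbrs_def)
  then obtain s where "s < length L" "fst (L ! s) = i" "w = cell s k"
    using ik by (auto simp: typed_nbrs_hub)
  then show "cell_valid DG DK w i k" using cell_valid_cell ik by blast
qed

end

lemma graph_of_derivation:
  assumes L: "justified L" and r: "r < length L" "fst (L ! r) = root"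
      "\<And>s. s < length L \<Longrightarrow> fst (L ! s) = root \<Longrightarrow> s = r"
    and C: "\<And>h bs. (h, bs) \<in> set C \<Longrightarrow> distinct (map fst bs)" vars_bounded and d: "0 < d"
  shows "\<exists>(G :: nat graph) key u. is_graph n G \<and> u \<in> verts G \<and> is_keying G key \<and>
    valid_at (snd (L ! r) 0) G key u"
proof -
  define m where "m = Max ((\<lambda>(s, j). snd (L ! s) j) ` ({..<length L} \<times> {..<d}))"
  have m: "snd (L ! s) j \<le> m" if "s < length L" "j < d" for s j
    unfolding m_def using that by (intro Max_ge) auto
  \<comment> \<open>\<open>B\<close> has to exceed both the positions in \<open>L\<close> and all
    register values, so that fractional parts stay below 1.\<close>
  define B where "B = Suc (m + length L)"
  have B: "length L < B" "\<And>s j. s < length L \<Longrightarrow> j < d \<Longrightarrow> snd (L ! s) j < B"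
    by (simp_all add: B_def less_Suc_eq_le trans_le_add1[OF m])
  show ?thesis
  proof (intro exI conjI)
    show "is_graph n (graph_of n B L)" by (rule is_graph_graph_of[OF L B C])
    show "prod_encode (0, 0) \<in> verts (graph_of n B L)"
      using B(1) by (auto simp: graph_of_def cell_type_def)
    show "is_keying (graph_of n B L) (key_of B)" by (rule is_keying_graph_of)
    show "valid_at (snd (L ! r) 0) (graph_of n B L) (key_of B) (prod_encode (0, 0))"
      by (rule valid_at_graph_of[OF L B C r d])
  qed
qed

end

section \<open>Undecidability\<close>

fun hterm_vars :: "hterm \<Rightarrow> nat set" where
  "hterm_vars HZero = {}"
| "hterm_vars (HVar j) = {j}"
| "hterm_vars (HSuc j) = {j}"

lemma vars_bounded_exists: "\<exists>d>0. derivation_checker.vars_bounded C d"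
proof -
  define V where "V = (\<Union>(h, bs)\<in>set C. \<Union>(q, ts)\<in>set (h # bs). \<Union>t\<in>set ts. hterm_vars t)"
  have "finite (hterm_vars t)" for t by (cases t) auto
  then have "finite V" unfolding V_def by auto
  then obtain d where d: "\<And>j. j \<in> V \<Longrightarrow> j < d"
    unfolding finite_nat_set_iff_bounded by blast
  have "j < Suc d" if "(h, bs) \<in> set C" "(q, ts) \<in> set (h # bs)" "t \<in> set ts" "t = HVar j \<or> t = HSuc j"
    for h bs q ts t j
  proof -
    have "j \<in> hterm_vars t" using that(4) by auto
    then have "j \<in> V" unfolding V_def using that(1-3) by blast
    then show ?thesis using d by (simp add: less_SucI)
  qed
  then have "derivation_checker.vars_bounded C (Suc d)"
    unfolding derivation_checker.vars_bounded_def by blast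
  then show ?thesis by blast
qed

lemma valid_at_exists_iff:
  fixes g :: recf
  defines "C \<equiv> clauses g 1 @ [root_clause g]" and "r \<equiv> length (clauses g 1)"
  assumes d: "0 < d" and vars: "derivation_checker.vars_bounded C d"
  shows "(\<exists>(G :: nat graph) key u. is_graph n G \<and> u \<in> verts G \<and> is_keying G key \<and>
      derivation_checker.valid_at C d r x G key u) \<longleftrightarrow> (\<exists>y. computes g [x] (Suc y))"
proof
  have root: "r < length C" "C ! r = root_clause g" by (simp_all add: C_def r_def)
  {
    assume "\<exists>(G :: nat graph) key u. is_graph n G \<and> u \<in> verts G \<and> is_keying G key \<and>
      derivation_checker.valid_at C d r x G key u"
    then obtain G :: "nat graph" and key u where G: "is_graph n G" "is_keying G key" "u \<in> verts G"
      "derivation_checker.valid_at C d r x G key u" by blast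
    have "derivable (set C) (Root g, [real x])"
      by (rule derivation_checker.derivable_of_valid_at[OF G vars root(1)])
        (simp add: root(2) root_clause_def)
    then show "\<exists>y. computes g [x] (Suc y)"
      using derivable_Root_imp_computes unfolding C_def by blast
  }
  assume "\<exists>y. computes g [x] (Suc y)"
  then obtain y where "computes g [x] (Suc y)" by blast
  \<comment> \<open>The clauses of \<open>g\<close> alone suffice, so the root clause will be used
    only by the entry appended at the end.\<close>
  then have "derivable (set (clauses g 1)) (Main g, [x] @ [Suc y])"
    by (intro computes_imp_derivable) auto
  from derivation_checker.derivable_imp_justified[OF this] obtain L where
    L: "derivation_checker.justified (clauses g 1) L"
    and main: "\<exists>(i, a)\<in>set L. inst a (fst (clauses g 1 ! i)) = (Main g, [x, Suc y])"
    by auto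
  have ix: "fst (L ! s) < r" if "s < length L" for s
    using L that by (simp add: derivation_checker.justified_def r_def)
  then have nth: "C ! fst (L ! s) = clauses g 1 ! fst (L ! s)" if "s < length L" for s
    using that by (simp add: C_def r_def nth_append)
  have "derivation_checker.justified C L"
    unfolding derivation_checker.justified_def
  proof (intro allI impI conjI ballI)
    fix s assume s: "s < length L"
    show "fst (L ! s) < length C" using ix[OF s] root(1) by simp
    fix b assume "b \<in> set (snd (C ! fst (L ! s)))"
    then obtain s' where "s' < s"
      "inst (snd (L ! s')) (fst (clauses g 1 ! fst (L ! s'))) = inst (snd (L ! s)) b"
      using L s nth[OF s] by (auto simp: derivation_checker.justified_def)
    then show "\<exists>s'<s. inst (snd (L ! s')) (fst (C ! fst (L ! s'))) = inst (snd (L ! s)) b"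
      using nth[of s'] s by auto
  qed
  \<comment> \<open>The premise of the root clause becomes the derived fact: variable 0 is the input
    and variable 1 the predecessor of the value.\<close>
  moreover define a where "a j = (if j = 0 then x else y)" for j :: nat
  moreover have "\<exists>(i', a')\<in>set L. inst a' (fst (C ! i')) = inst a b" if "b \<in> set (snd (C ! r))" for b
  proof -
    obtain i' a' where ia: "(i', a') \<in> set L" "inst a' (fst (clauses g 1 ! i')) = (Main g, [x, Suc y])"
      using main by auto
    then have "C ! i' = clauses g 1 ! i'" using nth by (metis fst_conv in_set_conv_nth)
    moreover have "inst a b = (Main g, [x, Suc y])"
      using that root(2) by (simp add: root_clause_def a_def)
    ultimately show ?thesis using ia by (intro bexI[of _ "(i', a')"]) auto
  qed
  ultimately have J: "derivation_checker.justified C (L @ [(r, a)])"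
    using derivation_checker.justified_snoc root(1) by blast
  have "distinct (map fst bs)" if "(h, bs) \<in> set C" for h bs
    using that by (auto simp: C_def root_clause_def intro: distinct_body_clauses)
  note dist = this
  have "\<exists>(G :: nat graph) key u. is_graph n G \<and> u \<in> verts G \<and> is_keying G key \<and>
      derivation_checker.valid_at C d r (snd ((L @ [(r, a)]) ! length L) 0) G key u"
  proof (rule derivation_checker.graph_of_derivation[OF J _ _ _ dist vars d])
    fix s assume "s < length (L @ [(r, a)])" "fst ((L @ [(r, a)]) ! s) = r"
    then show "s = length L" using ix[of s] by (auto simp: nth_append split: if_splits)
  qed auto
  then show "\<exists>(G :: nat graph) key u. is_graph n G \<and> u \<in> verts G \<and> is_keying G key \<and>
      derivation_checker.valid_at C d r x G key u"
    by (simp add: a_def)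
qed

section \<open>Reduction and diagonal argument for an arbitrary description language\<close>

context layer_description
begin

text \<open>The description \<open>ls\<close> is chosen before \<open>n\<close>, \<open>x\<close>
  and the first layer; this independence makes the diagonal argument possible. Position
  \<open>n\<close> of the input vector is the key, which follows the \<open>n\<close> label
  bits.\<close>

lemma halting_network_exists:
  "\<exists>ls. wf_descr ok 2 ls \<and> (\<forall>n x com.
    (\<forall>v. length v = 2 * (n + 1) \<longrightarrow> com v = [v ! n, real x * v ! n]) \<longrightarrow>
    (key_invariant n ((max_agg (n + 1), com) # localmax_gnn sem 2 ls) \<longleftrightarrow>
      \<not> (\<exists>y. computes g [x] (Suc y))))"
proof -
  let ?C = "clauses g 1 @ [root_clause g]" and ?r = "length (clauses g 1)"
  obtain d where d: "0 < d" "derivation_checker.vars_bounded ?C d"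
    using vars_bounded_exists by blast
  let ?verify = "derivation_checker.verify ?C d ?r" and ?valid = "derivation_checker.valid_at ?C d ?r"
  obtain ls ns where ls: "gnn_implements ls ns [collect, ?verify, decide] Out"
    using gnn_exists[of "[collect, ?verify, decide]"]
      semilinear_collect derivation_checker.semilinear_verify semilinear_decide by fastforce
  obtain ds where "layer_implements ds [Key, Par] emit ns"
    using layer_exists[of ns emit "[Key, Par]"] semilinear_emit by auto
  from gnn_implements_Cons[OF this ls]
  have ls: "gnn_implements (ds # ls) [Key, Par] [emit, collect, ?verify, decide] Out" .
  have "key_invariant n ((max_agg (n + 1), com) # localmax_gnn sem 2 (ds # ls)) \<longleftrightarrow>
      \<not> (\<exists>y. computes g [x] (Suc y))"
    if com: "\<forall>v. length v = 2 * (n + 1) \<longrightarrow> com v = [v ! n, real x * v ! n]" for n x com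
  proof -
    let ?N = "(max_agg (n + 1), com) # localmax_gnn sem 2 (ds # ls)"
    have acc: "accepts ?N G key u \<longleftrightarrow> ?valid x G key u"
      if G: "is_graph n G" and key: "is_keying G key" and u: "u \<in> verts G"
      for G :: "nat graph" and key u
    proof -
      define emb where "emb v = com (init_emb G key v @ max_agg (n + 1)
        {# init_emb G key w. w \<in># mset_set {w. (v, w) \<in> edges G} #})" for v
      have "emb v = map (derivation_checker.init_state x key v) [Key, Par]" if "v \<in> verts G" for v
      proof -
        have "length (lab G v) = n" using G that by (simp add: is_graph_def)
        then show ?thesis
          using com by (simp add: emb_def init_emb_def max_agg_def nth_append
              derivation_checker.init_state_def)
      qed
      then have "run G (localmax_gnn sem (length [Key, Par]) (ds # ls)) emb u
        = [fold (layer_step G) [emit, collect, ?verify, decide] (derivation_checker.init_state x key) u Out]"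
        by (intro conjunct2[OF ls[unfolded gnn_implements_def], rule_format, OF G _ u])
      then have "run G ?N (init_emb G key) u
        = [fold (layer_step G) [emit, collect, ?verify, decide] (derivation_checker.init_state x key) u Out]"
        by (simp add: emb_def[abs_def] numeral_2_eq_2 del: localmax_gnn.simps fold.simps fold_simps)
      then show ?thesis
        using derivation_checker.network_valid_at[OF G key] unfolding accepts_def by simp
    qed
    show ?thesis
    proof
      assume inv: "key_invariant n ?N"
      show "\<not> (\<exists>y. computes g [x] (Suc y))"
      proof
        assume "\<exists>y. computes g [x] (Suc y)"
        then obtain G :: "nat graph" and key u where G: "is_graph n G" "u \<in> verts G"
          "is_keying G key" "?valid x G key u"
          using valid_at_exists_iff[OF d, of n x] by blast
        \<comment> \<open>A valid hub has a key between 0 and 1, so negating all keys destroys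
          validity while keeping them distinct: both outcomes occur on the same pointed
          graph.\<close>
        have neg: "is_keying G (\<lambda>v. - key v)" using G(3) by (auto simp: is_keying_def inj_on_def)
        have "\<not> ?valid x G (\<lambda>v. - key v) u"
          using G(4) by (auto simp: derivation_checker.valid_at_def in_type_def)
        then show False
          using inv G acc[OF G(1,3,2)] acc[OF G(1) neg G(2)] neg unfolding key_invariant_def by blast
      qed
    next
      assume "\<not> (\<exists>y. computes g [x] (Suc y))"
      then have "\<not> ?valid x G key u" if "is_graph n G" "u \<in> verts G" "is_keying G key"
        for G :: "nat graph" and key u
        using that valid_at_exists_iff[OF d, of n x] by blast
      then show "key_invariant n ?N"
        using acc unfolding key_invariant_def by blast
    qed
  qed
  moreover have "wf_descr ok 2 (ds # ls)" using ls by (simp add: gnn_implements_def)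
  ultimately show ?thesis by blast
qed

theorem key_invariance_undecidable:
  assumes q: "\<And>x. ok (2 * (n + 1)) (q x)"
      "\<And>x v. length v = 2 * (n + 1) \<Longrightarrow> sem (q x) v = real x * v ! n"
    and enc: "rec_fun 1 (\<lambda>xs. enc (q (xs ! 0)))"
  shows "\<not> decidable_on (enc_descr enc) {ls. wf_descr ok (n + 1) ls}
    (\<lambda>ls. key_invariant n (localmax_gnn sem (n + 1) ls))"
proof
  assume "decidable_on (enc_descr enc) {ls. wf_descr ok (n + 1) ls}
    (\<lambda>ls. key_invariant n (localmax_gnn sem (n + 1) ls))"
  then obtain f where f: "\<And>ls. wf_descr ok (n + 1) ls \<Longrightarrow> computes f [enc_descr enc ls]
      (if key_invariant n (localmax_gnn sem (n + 1) ls) then 1 else 0)"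
    unfolding decidable_on_def by blast
  obtain dk where dk: "ok (2 * (n + 1)) dk" "\<And>v. length v = 2 * (n + 1) \<Longrightarrow> sem dk v = v ! n"
    using represents_semilinear[OF semilinear_var[of n "{..<2 * (n + 1)}"]] by auto
  \<comment> \<open>As \<open>list_encode\<close> sends a nonempty list to the successor of a
    pairing of its head and the code of its tail, this is the code of the description with first
    layer \<open>[dk, q x]\<close> and remaining layers of code \<open>x\<close>.\<close>
  have "rec_fun 1 (\<lambda>xs. Suc (prod_encode (Suc (prod_encode (enc dk,
      Suc (prod_encode (enc (q (xs ! 0)), 0)))), xs ! 0)))"
    by (intro rec_fun_Suc rec_fun_prod_encode rec_fun_const rec_fun_proj enc) auto
  then obtain s where s: "\<And>x. computes s [x] (Suc (prod_encode (Suc (prod_encode (enc dk,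
      Suc (prod_encode (enc (q x), 0)))), x)))"
    unfolding rec_fun_def by (metis One_nat_def length_Cons list.size(3) nth_Cons_0)
  define g where "g = Comp f [s]"
  obtain ls where ls: "wf_descr ok 2 ls"
    and inv: "\<And>x com. \<forall>v. length v = 2 * (n + 1) \<longrightarrow> com v = [v ! n, real x * v ! n] \<Longrightarrow>
      key_invariant n ((max_agg (n + 1), com) # localmax_gnn sem 2 ls) \<longleftrightarrow>
        \<not> (\<exists>y. computes g [x] (Suc y))"
    using halting_network_exists[of g] by blast
  \<comment> \<open>The remaining layers were built for \<open>g\<close> and receive their own code,
    so \<open>s\<close> maps \<open>x\<close> to the code of \<open>N\<close> itself. Then
    \<open>g\<close> has the value 1 at \<open>x\<close> if \<open>N\<close> is key-invariant and 0
    otherwise, but invariance of \<open>N\<close> means that \<open>g\<close> has no positive value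
    there.\<close>
  define x where "x = enc_descr enc ls"
  define N where "N = [dk, q x] # ls"
  have "wf_descr ok (n + 1) N" using ls dk(1) q(1) by (simp add: N_def numeral_2_eq_2)
  moreover have "computes s [x] (enc_descr enc N)"
    using s[of x] by (simp add: N_def x_def enc_descr_def)
  ultimately have comp: "computes g [x] (if key_invariant n (localmax_gnn sem (n + 1) N) then 1 else 0)"
    unfolding g_def by (intro computes.comp[where ys = "[enc_descr enc N]"] f) auto
  have "key_invariant n (localmax_gnn sem (n + 1) N) \<longleftrightarrow> \<not> (\<exists>y. computes g [x] (Suc y))"
    using inv[of "\<lambda>v. map (\<lambda>d. sem d v) [dk, q x]" x] dk(2) q(2)
    by (simp add: N_def numeral_2_eq_2)
  with comp show False
    by (auto split: if_splits dest: computes_deterministic)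
qed

end

section \<open>The two concrete description languages\<close>

interpretation sexp: layer_description sexp_ok sexp_fun
  using sexp_represents_semilinear by unfold_locales blast

interpretation fo: layer_description fo_ok fo_fun
  using fo_form_represents_semilinear by unfold_locales blast

text \<open>The formulas have no scalars, so multiplication by \<open>x\<close> is unrolled into a
  sum; its code is a primitive recursion in \<open>x\<close>.\<close>

fun fo_multiple :: "nat \<Rightarrow> nat \<Rightarrow> fo_term" where
  "fo_multiple i 0 = TZero"
| "fo_multiple i (Suc x) = TPlus (fo_multiple i x) (TVar i)"

lemma tm_val_fo_multiple: "tm_val e (fo_multiple i x) = real x * e i"
  by (induction x) (auto simp: algebra_simps)

lemma tm_vars_fo_multiple: "tm_vars (fo_multiple i x) \<subseteq> {i}"
  by (induction x) auto

lemma rec_fun_enc_fo_multiple: "rec_fun 1 (\<lambda>xs. enc_term (fo_multiple i (xs ! 0)))"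
proof (rule rec_fun_cong)
  show "rec_fun 1 (\<lambda>xs. rec_nat ((\<lambda>xs. enc_term TZero) (tl xs))
      (\<lambda>m r. (\<lambda>xs. prod_encode (3, prod_encode (xs ! 1, enc_term (TVar i)))) (m # r # tl xs)) (hd xs))"
    unfolding One_nat_def
    by (intro rec_fun_prim_rec rec_fun_prod_encode rec_fun_proj rec_fun_const) auto
  fix xs :: "nat list" assume "length xs = 1"
  then obtain x where xs: "xs = [x]" by (auto simp: length_Suc_conv)
  have "rec_nat (enc_term TZero) (\<lambda>m r. prod_encode (3, prod_encode (r, enc_term (TVar i)))) x
    = enc_term (fo_multiple i x)" by (induction x) auto
  then show "rec_nat ((\<lambda>xs. enc_term TZero) (tl xs))
      (\<lambda>m r. (\<lambda>xs. prod_encode (3, prod_encode (xs ! 1, enc_term (TVar i)))) (m # r # tl xs)) (hd xs)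
    = enc_term (fo_multiple i (xs ! 0))" by (simp add: xs)
qed

lemma enc_rat_of_nat: "enc_rat (of_nat x) = prod_encode (x + x, 2)"
proof -
  have "quotient_of (of_nat x) = (int x, 1)"
    using quotient_of_int[of "int x"] by simp
  then show ?thesis by (simp add: enc_rat_def int_encode_def sum_encode_def)
qed

theorem theorem6p4:
  fixes n :: nat
  shows "\<not> decidable_on (enc_descr enc_form) {ls. wf_descr fo_ok (n + 1) ls}
             (\<lambda>ls. key_invariant n (localmax_gnn fo_fun (n + 1) ls))
       \<and> \<not> decidable_on (enc_descr enc_sexp) {ls. wf_descr sexp_ok (n + 1) ls}
             (\<lambda>ls. key_invariant n (localmax_gnn sexp_fun (n + 1) ls))"
proof
  define \<phi> where "\<phi> x = FEq (TVar (2 * (n + 1))) (fo_multiple n x)" for x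
  have \<phi>: "fo_ok (2 * (n + 1)) (\<phi> x) \<and>
      (\<forall>v. length v = 2 * (n + 1) \<longrightarrow> fo_fun (\<phi> x) v = real x * v ! n)" for x
  proof (rule fo_fun_eqI)
    show "free_vars (\<phi> x) \<subseteq> {..2 * (n + 1)}"
      using tm_vars_fo_multiple[of n x] by (auto simp: \<phi>_def)
    fix v :: vec and y assume "length v = 2 * (n + 1)"
    then show "sat ((!) (v @ [y])) (\<phi> x) \<longleftrightarrow> y = real x * v ! n"
      by (auto simp: \<phi>_def tm_val_fo_multiple nth_append)
  qed
  show "\<not> decidable_on (enc_descr enc_form) {ls. wf_descr fo_ok (n + 1) ls}
      (\<lambda>ls. key_invariant n (localmax_gnn fo_fun (n + 1) ls))"
  proof (rule fo.key_invariance_undecidable[of n \<phi>])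
    show "rec_fun 1 (\<lambda>xs. enc_form (\<phi> (xs ! 0)))"
      unfolding \<phi>_def enc_form.simps
      by (intro rec_fun_prod_encode rec_fun_const rec_fun_enc_fo_multiple)
  qed (use \<phi> in auto)
  show "\<not> decidable_on (enc_descr enc_sexp) {ls. wf_descr sexp_ok (n + 1) ls}
      (\<lambda>ls. key_invariant n (localmax_gnn sexp_fun (n + 1) ls))"
  proof (rule sexp.key_invariance_undecidable[of n "\<lambda>x. SScale (of_nat x) (SVar n)"])
    show "rec_fun 1 (\<lambda>xs. enc_sexp (SScale (of_nat (xs ! 0)) (SVar n)))"
      unfolding enc_sexp.simps enc_rat_of_nat
      by (intro rec_fun_prod_encode rec_fun_const rec_fun_add rec_fun_proj) auto
  qed (auto simp: sexp_ok_def)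
qed

end
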